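(* Let $F$ be an algebraically closed field with $\operatorname{char}F\neq2$, let $V$ be an infinite-dimensional vector space over $F$ and $f$ a nondegenerate quadratic form on $V$. Then the Clifford algebra $Cl(V,f)$ is a locally matrix algebra and $\mathbf{n}(Cl(V,f))=2^{\infty}$.
   Context: A quadratic form on $V$ is a map $f:V\to F$ with $f(\alpha v)=\alpha^2f(v)$ for all $\alpha\in F$, $v\in V$, such that $f(u,v)=f(u+v)-f(u)-f(v)$ is a bilinear form; $f$ is nondegenerate if this bilinear form is nondegenerate. The Clifford algebra $Cl(V,f)$ is the unital associative algebra generated by $V$ and $1$ subject to $v^2=f(v)\cdot1$ for all $v\in V$. A unital algebra $A$ is locally matrix if every finite subset lies in a subalgebra $B$ with $1_A\in B$ and $B\cong M_n(F)$ for some $n$. For such $A$, $D(A)$ is the set of $n$ with a unital subalgebra isomorphic to $M_n(F)$, and the Steinitz number $\mathbf{n}(A)$ is the least common multiple of $D(A)$ in the lattice of Steinitz numbers $\prod_p p^{r_p}$, $r_p\in\mathbb{N}\cup\{0,\infty\}$; $2^\infty$ is the Steinitz number with exponent $\infty$ at $2$ and $0$ elsewhere. *)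

theory Defs
  imports "HOL-Computational_Algebra.Computational_Algebra" "HOL-Library.Extended_Nat"
begin

definition alg_closed :: "'k::field itself \<Rightarrow> bool" where
  "alg_closed _ \<longleftrightarrow> (\<forall>p :: 'k poly. 0 < degree p \<longrightarrow> (\<exists>x. poly p x = 0))"

definition infinite_dimensional :: "('k::field \<Rightarrow> 'v::ab_group_add \<Rightarrow> 'v) \<Rightarrow> bool" where
  "infinite_dimensional s \<longleftrightarrow> \<not> (\<exists>B. finite B \<and> module.span s B = UNIV)"

definition assoc_bilinear :: "('v::ab_group_add \<Rightarrow> 'k::field) \<Rightarrow> 'v \<Rightarrow> 'v \<Rightarrow> 'k" where
  "assoc_bilinear f u v = f (u + v) - f u - f v"

definition bilinear_form :: "('k::field \<Rightarrow> 'v::ab_group_add \<Rightarrow> 'v) \<Rightarrow> ('v \<Rightarrow> 'v \<Rightarrow> 'k) \<Rightarrow> bool" where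
  "bilinear_form s B \<longleftrightarrow>
     (\<forall>u. Vector_Spaces.linear s (*) (\<lambda>v. B u v)) \<and> (\<forall>v. Vector_Spaces.linear s (*) (\<lambda>u. B u v))"

definition quadratic_form :: "('k::field \<Rightarrow> 'v::ab_group_add \<Rightarrow> 'v) \<Rightarrow> ('v \<Rightarrow> 'k) \<Rightarrow> bool" where
  "quadratic_form s f \<longleftrightarrow> (\<forall>a v. f (s a v) = a^2 * f v) \<and> bilinear_form s (assoc_bilinear f)"

definition nondegenerate_qf :: "('v::ab_group_add \<Rightarrow> 'k::field) \<Rightarrow> bool" where
  "nondegenerate_qf f \<longleftrightarrow> (\<forall>u. (\<forall>v. assoc_bilinear f u v = 0) \<longrightarrow> u = 0)"

section \<open>Free unital associative algebra on the set V (noncommutative polynomials in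
  the symbols v \<in> V), realised as finitely supported functions on words\<close>

definition fa_carrier :: "('v list \<Rightarrow> 'k::field) set" where
  "fa_carrier = {a. finite {w. a w \<noteq> 0}}"

definition fa_add :: "('v list \<Rightarrow> 'k::field) \<Rightarrow> ('v list \<Rightarrow> 'k) \<Rightarrow> 'v list \<Rightarrow> 'k" where
  "fa_add a b = (\<lambda>w. a w + b w)"

definition fa_diff :: "('v list \<Rightarrow> 'k::field) \<Rightarrow> ('v list \<Rightarrow> 'k) \<Rightarrow> 'v list \<Rightarrow> 'k" where
  "fa_diff a b = (\<lambda>w. a w - b w)"

definition fa_scale :: "'k::field \<Rightarrow> ('v list \<Rightarrow> 'k) \<Rightarrow> 'v list \<Rightarrow> 'k" where
  "fa_scale c a = (\<lambda>w. c * a w)"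

definition fa_zero :: "'v list \<Rightarrow> 'k::field" where
  "fa_zero = (\<lambda>w. 0)"

definition fa_one :: "'v list \<Rightarrow> 'k::field" where
  "fa_one = (\<lambda>w. if w = [] then 1 else 0)"

definition fa_mult :: "('v list \<Rightarrow> 'k::field) \<Rightarrow> ('v list \<Rightarrow> 'k) \<Rightarrow> 'v list \<Rightarrow> 'k" where
  "fa_mult a b = (\<lambda>w. \<Sum>k\<le>length w. a (take k w) * b (drop k w))"

definition fa_gen :: "'v \<Rightarrow> 'v list \<Rightarrow> 'k::field" where
  "fa_gen v = (\<lambda>w. if w = [v] then 1 else 0)"

section \<open>The Clifford algebra Cl(V,f) = free algebra / two-sided ideal generated by the
  linearity relations of V and the relations v*v = f(v)*1\<close>

inductive_set cl_ideal :: "('k::field \<Rightarrow> 'v::ab_group_add \<Rightarrow> 'v) \<Rightarrow> ('v \<Rightarrow> 'k) \<Rightarrow> ('v list \<Rightarrow> 'k) set"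
  for s :: "'k::field \<Rightarrow> 'v::ab_group_add \<Rightarrow> 'v" and f :: "'v \<Rightarrow> 'k" where
  rel_add: "fa_diff (fa_gen (u + v)) (fa_add (fa_gen u) (fa_gen v)) \<in> cl_ideal s f"
| rel_scale: "fa_diff (fa_gen (s c v)) (fa_scale c (fa_gen v)) \<in> cl_ideal s f"
| rel_square: "fa_diff (fa_mult (fa_gen v) (fa_gen v)) (fa_scale (f v) fa_one) \<in> cl_ideal s f"
| zero: "fa_zero \<in> cl_ideal s f"
| add: "x \<in> cl_ideal s f \<Longrightarrow> y \<in> cl_ideal s f \<Longrightarrow> fa_add x y \<in> cl_ideal s f"
| scale: "x \<in> cl_ideal s f \<Longrightarrow> fa_scale c x \<in> cl_ideal s f"
| lmult: "x \<in> cl_ideal s f \<Longrightarrow> a \<in> fa_carrier \<Longrightarrow> fa_mult a x \<in> cl_ideal s f"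
| rmult: "x \<in> cl_ideal s f \<Longrightarrow> a \<in> fa_carrier \<Longrightarrow> fa_mult x a \<in> cl_ideal s f"

definition cl_eq :: "('k::field \<Rightarrow> 'v::ab_group_add \<Rightarrow> 'v) \<Rightarrow> ('v \<Rightarrow> 'k) \<Rightarrow>
    ('v list \<Rightarrow> 'k) \<Rightarrow> ('v list \<Rightarrow> 'k) \<Rightarrow> bool" where
  "cl_eq s f a b \<longleftrightarrow> fa_diff a b \<in> cl_ideal s f"

definition mat_carrier :: "nat \<Rightarrow> (nat \<Rightarrow> nat \<Rightarrow> 'k::field) set" where
  "mat_carrier n = {X. \<forall>i j. \<not> (i < n \<and> j < n) \<longrightarrow> X i j = 0}"

definition mat_add :: "(nat \<Rightarrow> nat \<Rightarrow> 'k::field) \<Rightarrow> (nat \<Rightarrow> nat \<Rightarrow> 'k) \<Rightarrow> nat \<Rightarrow> nat \<Rightarrow> 'k" where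
  "mat_add X Y = (\<lambda>i j. X i j + Y i j)"

definition mat_scale :: "'k::field \<Rightarrow> (nat \<Rightarrow> nat \<Rightarrow> 'k) \<Rightarrow> nat \<Rightarrow> nat \<Rightarrow> 'k" where
  "mat_scale c X = (\<lambda>i j. c * X i j)"

definition mat_mult :: "nat \<Rightarrow> (nat \<Rightarrow> nat \<Rightarrow> 'k::field) \<Rightarrow> (nat \<Rightarrow> nat \<Rightarrow> 'k) \<Rightarrow> nat \<Rightarrow> nat \<Rightarrow> 'k" where
  "mat_mult n X Y = (\<lambda>i j. \<Sum>k<n. X i k * Y k j)"

definition mat_one :: "nat \<Rightarrow> nat \<Rightarrow> nat \<Rightarrow> 'k::field" where
  "mat_one n = (\<lambda>i j. if i = j \<and> i < n then 1 else 0)"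

text \<open>An injective unital algebra homomorphism M_n(F) \<rightarrow> Cl(V,f), given on representatives;
  its image is a subalgebra containing 1 and isomorphic to M_n(F), and conversely.\<close>
definition cl_matrix_embedding :: "('k::field \<Rightarrow> 'v::ab_group_add \<Rightarrow> 'v) \<Rightarrow> ('v \<Rightarrow> 'k) \<Rightarrow> nat \<Rightarrow>
    ((nat \<Rightarrow> nat \<Rightarrow> 'k) \<Rightarrow> 'v list \<Rightarrow> 'k) \<Rightarrow> bool" where
  "cl_matrix_embedding s f n \<phi> \<longleftrightarrow>
     0 < n \<and>
     (\<forall>X\<in>mat_carrier n. \<phi> X \<in> fa_carrier) \<and>
     (\<forall>X\<in>mat_carrier n. \<forall>Y\<in>mat_carrier n. cl_eq s f (\<phi> (mat_add X Y)) (fa_add (\<phi> X) (\<phi> Y))) \<and>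
     (\<forall>c. \<forall>X\<in>mat_carrier n. cl_eq s f (\<phi> (mat_scale c X)) (fa_scale c (\<phi> X))) \<and>
     (\<forall>X\<in>mat_carrier n. \<forall>Y\<in>mat_carrier n. cl_eq s f (\<phi> (mat_mult n X Y)) (fa_mult (\<phi> X) (\<phi> Y))) \<and>
     cl_eq s f (\<phi> (mat_one n)) fa_one \<and>
     (\<forall>X\<in>mat_carrier n. \<forall>Y\<in>mat_carrier n. cl_eq s f (\<phi> X) (\<phi> Y) \<longrightarrow> X = Y)"

definition clifford_locally_matrix :: "('k::field \<Rightarrow> 'v::ab_group_add \<Rightarrow> 'v) \<Rightarrow> ('v \<Rightarrow> 'k) \<Rightarrow> bool" where
  "clifford_locally_matrix s f \<longleftrightarrow>
     (\<forall>S. S \<subseteq> fa_carrier \<and> finite S \<longrightarrow>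
        (\<exists>n \<phi>. cl_matrix_embedding s f n \<phi> \<and>
               (\<forall>a\<in>S. \<exists>X\<in>mat_carrier n. cl_eq s f a (\<phi> X))))"

definition clifford_D :: "('k::field \<Rightarrow> 'v::ab_group_add \<Rightarrow> 'v) \<Rightarrow> ('v \<Rightarrow> 'k) \<Rightarrow> nat set" where
  "clifford_D s f = {n. \<exists>\<phi>. cl_matrix_embedding s f n \<phi>}"

section \<open>Steinitz numbers: maps from primes to exponents in \<nat> \<union> {\<infinity>}\<close>

type_synonym steinitz = "nat \<Rightarrow> enat"

definition steinitz_lcm :: "nat set \<Rightarrow> steinitz" where
  "steinitz_lcm D = (\<lambda>p. if prime p then (SUP n\<in>D. enat (multiplicity p n)) else 0)"

definition steinitz_two_inf :: steinitz where
  "steinitz_two_inf = (\<lambda>p. if p = 2 then \<infinity> else 0)"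

end

theory Submission
  imports Defs "HOL-Library.Function_Algebras"
begin

text \<open>
  A nonzero vector of \<open>V\<close> orthogonal to a hyperbolic subspace lies in a hyperbolic plane orthogonal
  to that subspace (\<open>F\<close> is algebraically closed and \<open>V\<close> is infinite-dimensional), so every finite
  set of vectors lies in the span of finitely many mutually orthogonal hyperbolic pairs \<open>(x, y)\<close>.
  If \<open>z\<close> is the grading element (\<open>z\<^sup>2 = 1\<close>, \<open>z\<close> anticommutes with the earlier vectors) of the matrix
  algebra generated by \<open>m\<close> pairs, then for a further pair \<open>zx\<close> and \<open>zy\<close> commute with that algebra,
  square to zero and satisfy \<open>zx zy + zy zx = 1\<close>; they generate a commuting copy of \<open>M\<^sub>2(F)\<close>, and
  \<open>m\<close> pairs generate \<open>M\<^sub>n(F)\<close> with \<open>n = 2\<^sup>m\<close>. That \<open>1 \<noteq> 0\<close> in the Clifford algebra follows from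
  Chevalley's action on alternating functionals. A unital copy of \<open>M\<^sub>n(F)\<close> lies in such a matrix
  algebra of size \<open>2\<^sup>m\<close>, and decomposing the space of column vectors as \<open>n\<close> copies of the image of
  \<open>e\<^sub>1\<^sub>1\<close> gives \<open>n dvd 2\<^sup>m\<close>.
\<close>

section \<open>The free algebra as a ring\<close>

lemma fa_mult_Nil: "fa_mult a b [] = a [] * b []"
  by (simp add: fa_mult_def)

text \<open>Separating the cut before the first letter gives a recursion that shifts only the left
  factor; this makes products accessible to induction on the word.\<close>

lemma fa_mult_Cons: "fa_mult a b (v # w) = a [] * b (v # w) + fa_mult (\<lambda>u. a (v # u)) b w"
  unfolding fa_mult_def length_Cons sum.atMost_Suc_shift by simp

lemma fa_mult_add_left: "fa_mult (\<lambda>u. a u + a' u) b w = fa_mult a b w + fa_mult a' b w"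
  by (simp add: fa_mult_def algebra_simps sum.distrib)

lemma fa_mult_add_right: "fa_mult a (\<lambda>u. b u + b' u) w = fa_mult a b w + fa_mult a b' w"
  by (simp add: fa_mult_def algebra_simps sum.distrib)

lemma fa_mult_scale_left: "fa_mult (\<lambda>u. c * a u) b w = c * fa_mult a b w"
  by (simp add: fa_mult_def algebra_simps sum_distrib_left)

lemma fa_mult_scale_right: "fa_mult a (\<lambda>u. c * b u) w = c * fa_mult a b w"
  by (simp add: fa_mult_def algebra_simps sum_distrib_left)

lemma fa_mult_assoc: "fa_mult (fa_mult a b) c w = fa_mult a (fa_mult b c) w"
proof (induction w arbitrary: a b)
  case Nil
  then show ?case by (simp add: fa_mult_Nil)
next
  case (Cons v w)
  show ?case
    by (simp add: fa_mult_Cons fa_mult_Nil fa_mult_add_left fa_mult_scale_left Cons algebra_simps)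
qed

lemma fa_mult_one_left: "fa_mult fa_one a w = a w"
proof (cases w)
  case (Cons v u)
  have "fa_mult (\<lambda>u. 0) a u = 0" by (simp add: fa_mult_def)
  then show ?thesis using Cons by (simp add: fa_mult_Cons fa_one_def)
qed (simp add: fa_mult_Nil fa_one_def)

lemma fa_mult_one_right: "fa_mult a fa_one w = a w"
  by (induction w arbitrary: a) (simp_all add: fa_mult_Nil fa_mult_Cons fa_one_def)

text \<open>A word in the support of a product is a concatenation of words from the two
  supports.\<close>

lemma fa_mult_carrier:
  assumes "a \<in> fa_carrier" "b \<in> fa_carrier"
  shows "fa_mult a b \<in> fa_carrier"
proof -
  have "{w. fa_mult a b w \<noteq> 0} \<subseteq> (\<lambda>(u, v). u @ v) ` ({w. a w \<noteq> 0} \<times> {w. b w \<noteq> 0})"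
  proof
    fix w assume "w \<in> {w. fa_mult a b w \<noteq> 0}"
    then have "(\<Sum>k\<le>length w. a (take k w) * b (drop k w)) \<noteq> 0"
      by (simp add: fa_mult_def)
    then obtain k where "a (take k w) * b (drop k w) \<noteq> 0"
      by (rule sum.not_neutral_contains_not_neutral)
    then have "a (take k w) \<noteq> 0" "b (drop k w) \<noteq> 0" by auto
    then show "w \<in> (\<lambda>(u, v). u @ v) ` ({w. a w \<noteq> 0} \<times> {w. b w \<noteq> 0})"
      by (intro image_eqI[where x = "(take k w, drop k w)"]) auto
  qed
  then show ?thesis
    using assms unfolding fa_carrier_def by (auto intro: finite_subset)
qed

lemma fa_add_carrier:
  assumes "a \<in> fa_carrier" "b \<in> fa_carrier"
  shows "fa_add a b \<in> fa_carrier"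
  using assms unfolding fa_carrier_def fa_add_def
  by (auto intro: finite_subset[where B = "{w. a w \<noteq> 0} \<union> {w. b w \<noteq> 0}"])

lemma fa_scale_carrier: "a \<in> fa_carrier \<Longrightarrow> fa_scale c a \<in> fa_carrier"
  unfolding fa_carrier_def fa_scale_def
  by (auto elim: finite_subset[rotated])

lemma fa_zero_carrier: "fa_zero \<in> fa_carrier"
  by (simp add: fa_carrier_def fa_zero_def)

lemma fa_single_carrier: "(\<lambda>w. if w = u then c else 0) \<in> fa_carrier"
  by (auto simp: fa_carrier_def intro: finite_subset[where B = "{u}"])

text \<open>Packing the carrier into a type makes the free algebra an instance of
  \<open>ring_1\<close>, so that ring identities fall to \<open>algebra_simps\<close>;
  \<open>coef\<close> and \<open>Falg\<close> lead back to the functions of the statement.\<close>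

typedef (overloaded) ('v, 'k::field) falg = "fa_carrier :: ('v list \<Rightarrow> 'k) set"
  morphisms coef Falg
  using fa_zero_carrier by blast

setup_lifting type_definition_falg

instantiation falg :: (type, field) ring_1
begin

lift_definition zero_falg :: "('a, 'b) falg" is fa_zero by (rule fa_zero_carrier)
lift_definition one_falg :: "('a, 'b) falg" is fa_one
  unfolding fa_one_def by (rule fa_single_carrier)
lift_definition plus_falg :: "('a, 'b) falg \<Rightarrow> ('a, 'b) falg \<Rightarrow> ('a, 'b) falg" is fa_add
  by (rule fa_add_carrier)
lift_definition uminus_falg :: "('a, 'b) falg \<Rightarrow> ('a, 'b) falg" is "fa_scale (- 1)"
  by (rule fa_scale_carrier)
lift_definition times_falg :: "('a, 'b) falg \<Rightarrow> ('a, 'b) falg \<Rightarrow> ('a, 'b) falg" is fa_mult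
  by (rule fa_mult_carrier)
lift_definition minus_falg :: "('a, 'b) falg \<Rightarrow> ('a, 'b) falg \<Rightarrow> ('a, 'b) falg" is fa_diff
proof -
  fix a b :: "'a list \<Rightarrow> 'b" assume "a \<in> fa_carrier" "b \<in> fa_carrier"
  then have "fa_add a (fa_scale (- 1) b) \<in> fa_carrier"
    by (intro fa_add_carrier fa_scale_carrier)
  then show "fa_diff a b \<in> fa_carrier" by (simp add: fa_add_def fa_scale_def fa_diff_def)
qed

instance
proof
  fix a b c :: "('a, 'b) falg"
  show "a + b + c = a + (b + c)" by transfer (simp add: fa_add_def algebra_simps)
  show "a + b = b + a" by transfer (simp add: fa_add_def algebra_simps)
  show "0 + a = a" by transfer (simp add: fa_add_def fa_zero_def)
  show "- a + a = 0" by transfer (simp add: fa_add_def fa_scale_def fa_zero_def)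
  show "a - b = a + - b" by transfer (simp add: fa_add_def fa_scale_def fa_diff_def)
  show "a * b * c = a * (b * c)" by transfer (rule ext, rule fa_mult_assoc)
  show "1 * a = a" by transfer (rule ext, rule fa_mult_one_left)
  show "a * 1 = a" by transfer (rule ext, rule fa_mult_one_right)
  show "(a + b) * c = a * c + b * c"
    by transfer (rule ext, simp add: fa_add_def fa_mult_add_left)
  show "a * (b + c) = a * b + a * c"
    by transfer (rule ext, simp add: fa_add_def fa_mult_add_right)
  show "(0::('a, 'b) falg) \<noteq> 1"
    by transfer (auto simp: fa_zero_def fa_one_def fun_eq_iff)
qed

end

section \<open>Scalars and the basis of words\<close>

lift_definition fsc :: "'k::field \<Rightarrow> ('v, 'k) falg \<Rightarrow> ('v, 'k) falg" is fa_scale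
  by (rule fa_scale_carrier)

lift_definition word :: "'v list \<Rightarrow> ('v, 'k::field) falg" is "\<lambda>u w. if w = u then 1 else 0"
  by (rule fa_single_carrier)

abbreviation gen :: "'v \<Rightarrow> ('v, 'k::field) falg" where "gen v \<equiv> word [v]"

interpretation falg: vector_space "fsc :: 'k::field \<Rightarrow> ('v, 'k) falg \<Rightarrow> ('v, 'k) falg"
proof
  fix c d :: 'k and a b :: "('v, 'k) falg"
  show "fsc c (a + b) = fsc c a + fsc c b"
    by transfer (simp add: fa_add_def fa_scale_def algebra_simps)
  show "fsc (c + d) a = fsc c a + fsc d a"
    by transfer (simp add: fa_add_def fa_scale_def algebra_simps)
  show "fsc c (fsc d a) = fsc (c * d) a"
    by transfer (simp add: fa_scale_def algebra_simps)
  show "fsc 1 a = a" by transfer (simp add: fa_scale_def)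
qed

lemma fsc_mult_left [simp]: "fsc c a * b = fsc c (a * b)"
  by transfer (rule ext, simp add: fa_scale_def fa_mult_scale_left)

lemma fsc_mult_right [simp]: "a * fsc c b = fsc c (a * b)"
  by transfer (rule ext, simp add: fa_scale_def fa_mult_scale_right)

lemma word_Nil: "word [] = 1"
  by transfer (simp add: fa_one_def fun_eq_iff)

lemma word_append: "word (u @ v) = word u * word v"
proof (transfer, rule ext)
  fix u v w :: "'a list"
  show "(if w = u @ v then 1 else 0 :: 'b) =
    fa_mult (\<lambda>w. if w = u then 1 else 0) (\<lambda>w. if w = v then 1 else 0) w"
  proof (induction u arbitrary: w)
    case Nil
    show ?case using fa_mult_one_left[of "\<lambda>w. if w = v then 1 else 0 :: 'b" w]
      by (simp add: fa_one_def)
  next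
    case (Cons x u)
    have z: "fa_mult (\<lambda>w. 0) b w = 0" for b :: "'a list \<Rightarrow> 'b" and w
      by (simp add: fa_mult_def)
    show ?case
    proof (cases w)
      case Nil
      then show ?thesis by (simp add: fa_mult_Nil)
    next
      case w: (Cons y w')
      show ?thesis
      proof (cases "y = x")
        case True
        then show ?thesis using Cons[of w'] by (simp add: w fa_mult_Cons)
      next
        case False
        then show ?thesis by (simp add: w fa_mult_Cons z)
      qed
    qed
  qed
qed

lemma word_Cons: "word (v # w) = gen v * word w"
  using word_append[of "[v]" w] by simp

lemma coef_gen: "coef (gen v) = fa_gen v"
  by transfer (simp add: fa_gen_def fun_eq_iff)

lemma coef_sum: "coef (sum g A) w = (\<Sum>x\<in>A. coef (g x) w)"
  by (induction A rule: infinite_finite_induct)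
    (simp_all add: zero_falg.rep_eq fa_zero_def plus_falg.rep_eq fa_add_def)

lemma falg_word_expansion:
  fixes a :: "('v, 'k::field) falg"
  shows "finite {w. coef a w \<noteq> 0}" "a = (\<Sum>w | coef a w \<noteq> 0. fsc (coef a w) (word w))"
proof -
  show fin: "finite {w. coef a w \<noteq> 0}"
    using coef[of a] by (simp add: fa_carrier_def)
  have "coef (\<Sum>w | coef a w \<noteq> 0. fsc (coef a w) (word w)) u = coef a u" for u
  proof -
    have "coef (\<Sum>w | coef a w \<noteq> 0. fsc (coef a w) (word w)) u
      = (\<Sum>w | coef a w \<noteq> 0. if u = w then coef a w else 0)"
      unfolding coef_sum by (rule sum.cong) (simp_all add: fsc.rep_eq fa_scale_def word.rep_eq)
    also have "\<dots> = coef a u" by (simp only: sum.delta'[OF fin]) simp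
    finally show ?thesis .
  qed
  then show "a = (\<Sum>w | coef a w \<noteq> 0. fsc (coef a w) (word w))"
    unfolding coef_inject[symmetric] by (intro ext) (rule sym)
qed

text \<open>Words span the free algebra, so a property stable under sums need only be checked on
  scalar multiples of words.\<close>

lemma falg_induct [case_names zero add word]:
  assumes "P 0" "\<And>a b. P a \<Longrightarrow> P b \<Longrightarrow> P (a + b)" "\<And>c w. P (fsc c (word w))"
  shows "P a"
proof -
  have "P (\<Sum>w\<in>A. fsc (coef a w) (word w))" if "finite A" for A
    using that by induction (auto intro: assms)
  from this[OF falg_word_expansion(1)[of a]] show ?thesis
    by (simp only: falg_word_expansion(2)[symmetric])
qed

section \<open>Nontriviality of the Clifford algebra\<close>

text \<open>The linear functional with value \<open>h w\<close> at the basis element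
  \<open>word w\<close>.\<close>

definition lin_ext :: "('v list \<Rightarrow> 'k) \<Rightarrow> ('v, 'k::field) falg \<Rightarrow> 'k" where
  "lin_ext h a = (\<Sum>w | coef a w \<noteq> 0. coef a w * h w)"

text \<open>Cancellation can shrink the support of a sum; over a common finite index set the
  functionals can be compared term by term.\<close>

lemma lin_ext_superset:
  assumes "finite A" "{w. coef a w \<noteq> 0} \<subseteq> A"
  shows "lin_ext h a = (\<Sum>w\<in>A. coef a w * h w)"
  unfolding lin_ext_def using assms by (intro sum.mono_neutral_left) auto

lemma lin_ext_add: "lin_ext h (a + b) = lin_ext h a + lin_ext h b"
proof -
  let ?A = "{w. coef a w \<noteq> 0} \<union> {w. coef b w \<noteq> 0}"
  have fin: "finite ?A" using falg_word_expansion(1) by blast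
  have "{w. coef (a + b) w \<noteq> 0} \<subseteq> ?A"
    by (auto simp: plus_falg.rep_eq fa_add_def)
  then show ?thesis
    using lin_ext_superset[OF fin, of "a + b" h] lin_ext_superset[OF fin, of a h]
      lin_ext_superset[OF fin, of b h]
    by (simp add: sum.distrib[symmetric] plus_falg.rep_eq fa_add_def algebra_simps)
qed

lemma lin_ext_scale: "lin_ext h (fsc c a) = c * lin_ext h a"
proof -
  have "{w. coef (fsc c a) w \<noteq> 0} \<subseteq> {w. coef a w \<noteq> 0}"
    by (auto simp: fsc.rep_eq fa_scale_def)
  then have "lin_ext h (fsc c a) = (\<Sum>w | coef a w \<noteq> 0. coef (fsc c a) w * h w)"
    by (intro lin_ext_superset falg_word_expansion)
  then show ?thesis
    unfolding lin_ext_def by (simp add: sum_distrib_left fsc.rep_eq fa_scale_def mult.assoc)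
qed

lemma lin_ext_zero [simp]: "lin_ext h 0 = 0"
  by (simp add: lin_ext_def zero_falg.rep_eq fa_zero_def)

lemma lin_ext_diff: "lin_ext h (a - b) = lin_ext h a - lin_ext h b"
  using lin_ext_add[of h "a - b" b] by (simp add: algebra_simps)

lemma lin_ext_word [simp]: "lin_ext h (word w) = h w"
  using lin_ext_superset[of "{w}" "word w" h] by (auto simp: word.rep_eq split: if_splits)

text \<open>
  Representation of the Clifford algebra on the functionals dual to the exterior algebra
  (\<open>alternating\<close> below): with \<open>(L v g) w = g (v # w)\<close> the recursion defining
  \<open>contr\<close> says \<open>L u \<circ> contr B v + contr B v \<circ> L u = B v u\<close>, and \<open>act B v = L v + contr B v\<close>
  squares to \<open>B v v\<close> because both summands square to zero. No basis of \<open>V\<close> is needed.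
\<close>

fun contr :: "('v \<Rightarrow> 'v \<Rightarrow> 'k::field) \<Rightarrow> 'v \<Rightarrow> ('v list \<Rightarrow> 'k) \<Rightarrow> 'v list \<Rightarrow> 'k" where
  "contr B v g [] = 0"
| "contr B v g (u # w) = B v u * g w - contr B v (\<lambda>x. g (u # x)) w"

definition act :: "('v \<Rightarrow> 'v \<Rightarrow> 'k::field) \<Rightarrow> 'v \<Rightarrow> ('v list \<Rightarrow> 'k) \<Rightarrow> 'v list \<Rightarrow> 'k" where
  "act B v g = (\<lambda>w. g (v # w) + contr B v g w)"

lemma contr_add: "contr B v (\<lambda>w. g w + h w) w = contr B v g w + contr B v h w"
  by (induction w arbitrary: g h) (simp_all add: algebra_simps)

lemma contr_scale: "contr B v (\<lambda>w. c * g w) w = c * contr B v g w"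
  by (induction w arbitrary: g) (simp_all add: algebra_simps)

lemma contr_diff: "contr B v (\<lambda>w. g w - h w) w = contr B v g w - contr B v h w"
  by (induction w arbitrary: g h) (simp_all add: algebra_simps)

lemma contr_zero: "contr B v (\<lambda>w. 0) w = 0"
  by (induction w) simp_all

text \<open>Unfolding both contractions at the first letter \<open>u\<close> produces
  \<open>B v u * contr B v g w\<close> twice with opposite signs; what remains is the induction
  hypothesis for the shifted functional.\<close>

lemma contr_contr: "contr B v (contr B v g) w = 0"
  by (induction w arbitrary: g) (simp_all add: contr_diff contr_scale)

lemma contr_vec_add:
  assumes "\<And>w. B (u + v) w = B u w + B v w"
  shows "contr B (u + v) g w = contr B u g w + contr B v g w"
  by (induction w arbitrary: g) (simp_all add: assms algebra_simps)

lemma contr_vec_scale: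
  assumes "\<And>w. B (s c v) w = c * B v w"
  shows "contr B (s c v) g w = c * contr B v g w"
  by (induction w arbitrary: g) (simp_all add: assms algebra_simps)

text \<open>Multilinear functionals on words that vanish on the ideal generated by squares of
  vectors, that is, functionals on the exterior algebra.\<close>

definition alternating :: "('k::field \<Rightarrow> 'v::ab_group_add \<Rightarrow> 'v) \<Rightarrow> ('v list \<Rightarrow> 'k) \<Rightarrow> bool" where
  "alternating s g \<longleftrightarrow>
     (\<forall>w x w'. g (w @ x # x # w') = 0) \<and>
     (\<forall>w x y w'. g (w @ (x + y) # w') = g (w @ x # w') + g (w @ y # w')) \<and>
     (\<forall>w c x w'. g (w @ s c x # w') = c * g (w @ x # w'))"

lemma alternating_Cons:
  assumes "alternating s g"
  shows "alternating s (\<lambda>w. g (u # w))"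
  using assms unfolding alternating_def by (metis append_Cons)

text \<open>Contraction must stay within the alternating functionals for \<open>act\<close> to be
  iterated. At a repeated letter \<open>x\<close> the two contributions
  \<open>B v x * g (x # w')\<close> cancel; letters in front are handled by induction, since shifts
  of \<open>g\<close> are alternating too.\<close>

lemma alternating_contr:
  assumes g: "alternating s g"
    and B: "\<And>x y. B v (x + y) = B v x + B v y" "\<And>c x. B v (s c x) = c * B v x"
  shows "alternating s (contr B v g)"
proof -
  have "contr B v g (w @ x # x # w') = 0" if "alternating s g" for g w x w'
    using that
  proof (induction w arbitrary: g)
    case Nil
    then have "(\<lambda>w. g (x # x # w)) = (\<lambda>w. 0)"
      unfolding alternating_def by (metis append_Nil)
    then show ?case by (simp add: contr_zero)
  next
    case (Cons u w)
    then have "g (w @ x # x # w') = 0" by (simp add: alternating_def)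
    then show ?case using Cons.IH[OF alternating_Cons[OF Cons.prems]] by simp
  qed
  moreover have "contr B v g (w @ (x + y) # w') = contr B v g (w @ x # w') + contr B v g (w @ y # w')"
    if "alternating s g" for g w x y w'
    using that
  proof (induction w arbitrary: g)
    case Nil
    then have "(\<lambda>w. g ((x + y) # w)) = (\<lambda>w. g (x # w) + g (y # w))"
      unfolding alternating_def by (metis append_Nil)
    then show ?case by (simp add: contr_add B algebra_simps)
  next
    case (Cons u w)
    then have "g (w @ (x + y) # w') = g (w @ x # w') + g (w @ y # w')"
      by (simp add: alternating_def)
    then show ?case using Cons.IH[OF alternating_Cons[OF Cons.prems], of u]
      by (simp add: algebra_simps)
  qed
  moreover have "contr B v g (w @ s c x # w') = c * contr B v g (w @ x # w')"
    if "alternating s g" for g w c x w'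
    using that
  proof (induction w arbitrary: g)
    case Nil
    then have "(\<lambda>w. g (s c x # w)) = (\<lambda>w. c * g (x # w))"
      unfolding alternating_def by (metis append_Nil)
    then show ?case by (simp add: contr_scale B algebra_simps)
  next
    case (Cons u w)
    then have "g (w @ s c x # w') = c * g (w @ x # w')"
      by (simp add: alternating_def)
    then show ?case using Cons.IH[OF alternating_Cons[OF Cons.prems], of u]
      by (simp add: algebra_simps)
  qed
  ultimately show ?thesis using g unfolding alternating_def[of s "contr B v g"] by blast
qed

lemma alternating_add:
  assumes "alternating s g" "alternating s h"
  shows "alternating s (\<lambda>w. g w + h w)"
  using assms unfolding alternating_def by (simp add: algebra_simps)

lemma alternating_scale:
  assumes "alternating s g"
  shows "alternating s (\<lambda>w. c * g w)"
  using assms unfolding alternating_def by (simp add: algebra_simps)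

lemma alternating_zero: "alternating s (\<lambda>w. 0)"
  by (simp add: alternating_def)

text \<open>Alternation enters as \<open>g (v # v # w) = 0\<close>; the recursion of
  \<open>contr\<close> reduces the two mixed terms to \<open>B v v * g w\<close>.\<close>

lemma act_act:
  assumes "alternating s g"
  shows "act B v (act B v g) w = B v v * g w"
proof -
  have "g (v # v # w) = 0" using assms unfolding alternating_def by (metis append_Nil)
  then show ?thesis unfolding act_def by (simp add: contr_add contr_contr)
qed

lemma foldr_act_add:
  "foldr (act B) u (\<lambda>w. g w + h w) = (\<lambda>w. foldr (act B) u g w + foldr (act B) u h w)"
  by (induction u) (simp_all add: act_def contr_add algebra_simps)

lemma foldr_act_scale:
  "foldr (act B) u (\<lambda>w. c * g w) = (\<lambda>w. c * foldr (act B) u g w)"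
  by (induction u) (simp_all add: act_def contr_scale algebra_simps)

text \<open>With \<open>foldr\<close> the leftmost letter acts last, so concatenating words composes
  operators and \<open>rep\<close> is multiplicative.\<close>

definition rep :: "('v \<Rightarrow> 'v \<Rightarrow> 'k::field) \<Rightarrow> ('v, 'k) falg \<Rightarrow> ('v list \<Rightarrow> 'k) \<Rightarrow> 'v list \<Rightarrow> 'k" where
  "rep B a g = (\<lambda>w. lin_ext (\<lambda>u. foldr (act B) u g w) a)"

lemma rep_add: "rep B (a + b) g w = rep B a g w + rep B b g w"
  by (simp add: rep_def lin_ext_add)

lemma rep_diff: "rep B (a - b) g w = rep B a g w - rep B b g w"
  by (simp add: rep_def lin_ext_diff)

lemma rep_scale: "rep B (fsc c a) g w = c * rep B a g w"
  by (simp add: rep_def lin_ext_scale)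

lemma rep_word: "rep B (word u) g = foldr (act B) u g"
  by (simp add: rep_def)

lemma rep_zero: "rep B 0 g w = 0"
  by (simp add: rep_def)

lemma rep_fun_add: "rep B a (\<lambda>w. g w + h w) w = rep B a g w + rep B a h w"
  by (simp add: rep_def lin_ext_def foldr_act_add sum.distrib algebra_simps)

lemma rep_fun_scale: "rep B a (\<lambda>w. c * g w) w = c * rep B a g w"
  by (simp add: rep_def lin_ext_def foldr_act_scale sum_distrib_left algebra_simps)

lemma rep_fun_zero: "rep B a (\<lambda>w. 0) w = 0"
  using rep_fun_scale[of B a 0 "\<lambda>w. 0" w] by simp

lemma rep_mult: "rep B (a * b) g w = rep B a (rep B b g) w"
proof (induction a rule: falg_induct)
  case zero
  show ?case by (simp add: rep_zero)
next
  case (add a a')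
  then show ?case by (simp add: rep_add distrib_right)
next
  case (word c u)
  have "rep B (word u * b) g w = rep B (word u) (rep B b g) w"
  proof (induction b rule: falg_induct)
    case zero
    have "rep B 0 g = (\<lambda>w. 0)" by (simp add: rep_zero fun_eq_iff)
    then show ?case by (simp add: rep_zero rep_fun_zero)
  next
    case (add b b')
    have "rep B (b + b') g = (\<lambda>w. rep B b g w + rep B b' g w)" by (simp add: rep_add fun_eq_iff)
    then show ?case using add by (simp add: rep_add rep_fun_add distrib_left)
  next
    case (word d v)
    have "rep B (fsc d (word v)) g = (\<lambda>w. d * rep B (word v) g w)"
      by (simp add: rep_scale fun_eq_iff)
    then show ?case
      by (simp add: rep_fun_scale rep_scale word_append[symmetric]) (simp add: rep_word)
  qed
  then show ?case by (simp add: rep_scale)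
qed

section \<open>The quadratic form and the Clifford ideal\<close>

locale clifford = vector_space s
  for s :: "'k::field \<Rightarrow> 'v::ab_group_add \<Rightarrow> 'v" +
  fixes f :: "'v \<Rightarrow> 'k"
  assumes quadratic: "quadratic_form s f"
    and two_neq_0: "(2::'k) \<noteq> 0"
begin

abbreviation b :: "'v \<Rightarrow> 'v \<Rightarrow> 'k" where "b \<equiv> assoc_bilinear f"

lemma f_scale [simp]: "f (s c v) = c\<^sup>2 * f v"
  using quadratic by (simp add: quadratic_form_def)

lemma b_sym: "b u v = b v u"
  by (simp add: assoc_bilinear_def add.commute)

lemma b_left [simp]:
  "b (u + v) w = b u w + b v w" "b (s c v) w = c * b v w"
  using quadratic
  by (simp_all add: quadratic_form_def bilinear_form_def Vector_Spaces.linear_iff)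

lemma b_right [simp]:
  "b w (u + v) = b w u + b w v" "b w (s c v) = c * b w v"
  using b_sym b_left by metis+

lemma b_diff_zero [simp]:
  "b (u - v) w = b u w - b v w" "b w (u - v) = b w u - b w v" "b 0 w = 0" "b w 0 = 0"
  using b_left(1)[of "u - v" v w] b_right(1)[of w "u - v" v] b_left(2)[of 0 0 w] b_right(2)[of w 0 0]
  by (simp_all add: algebra_simps)

lemma f_add: "f (u + v) = f u + f v + b u v"
  by (simp add: assoc_bilinear_def)

lemma b_self [simp]: "b v v = 2 * f v"
proof -
  have "v + v = s 2 v" using scale_left_distrib[of 1 1 v] by simp
  then show ?thesis by (simp add: assoc_bilinear_def)
qed

lemma f_diff: "f (u - v) = f u + f v - b u v"
  using f_add[of "u - v" v] by (simp add: algebra_simps)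

text \<open>The quotient is never formed as a type: the Clifford algebra is handled as the ring
  \<open>falg\<close> modulo this ideal.\<close>

definition I :: "('v, 'k) falg set" where "I = {a. coef a \<in> cl_ideal s f}"

lemma I_zero [simp]: "0 \<in> I"
  by (simp add: I_def zero_falg.rep_eq cl_ideal.zero)

lemma I_add: "x \<in> I \<Longrightarrow> y \<in> I \<Longrightarrow> x + y \<in> I"
  by (simp add: I_def plus_falg.rep_eq cl_ideal.add)

lemma I_scale: "x \<in> I \<Longrightarrow> fsc c x \<in> I"
  by (simp add: I_def fsc.rep_eq cl_ideal.scale)

lemma I_lmult: "x \<in> I \<Longrightarrow> a * x \<in> I"
  using coef[of a] by (simp add: I_def times_falg.rep_eq cl_ideal.lmult)

lemma I_rmult: "x \<in> I \<Longrightarrow> x * a \<in> I"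
  using coef[of a] by (simp add: I_def times_falg.rep_eq cl_ideal.rmult)

lemma I_uminus: "x \<in> I \<Longrightarrow> - x \<in> I"
  using I_lmult[of x "- 1"] by simp

lemma I_diff: "x \<in> I \<Longrightarrow> y \<in> I \<Longrightarrow> x - y \<in> I"
  using I_add[OF _ I_uminus] by force

lemma I_sum: "(\<And>i. i \<in> A \<Longrightarrow> g i \<in> I) \<Longrightarrow> sum g A \<in> I"
  by (induction A rule: infinite_finite_induct) (simp_all add: I_add)

lemmas I_intros = I_zero I_add I_scale I_lmult I_rmult I_uminus I_diff I_sum

lemma I_gen_add: "gen (u + v) - (gen u + gen v) \<in> I"
  using cl_ideal.rel_add[of u v s f]
  by (simp add: I_def minus_falg.rep_eq plus_falg.rep_eq coef_gen)

lemma I_gen_scale: "gen (s c v) - fsc c (gen v) \<in> I"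
  using cl_ideal.rel_scale[of s c v f]
  by (simp add: I_def minus_falg.rep_eq fsc.rep_eq coef_gen)

lemma I_gen_square: "gen v * gen v - fsc (f v) 1 \<in> I"
  using cl_ideal.rel_square[of v f s]
  by (simp add: I_def minus_falg.rep_eq times_falg.rep_eq fsc.rep_eq one_falg.rep_eq coef_gen)

text \<open>The form used is half the polar form, whose diagonal is \<open>f v\<close> because
  \<open>b v v = 2 * f v\<close>; by \<open>act_act\<close> the operator of \<open>v\<close> then
  squares to \<open>f v\<close>.\<close>

lemma rep_alternating:
  assumes "alternating s g"
  shows "alternating s (rep (\<lambda>u v. b u v / 2) a g)"
proof (induction a rule: falg_induct)
  case zero
  show ?case by (simp add: alternating_zero rep_zero[abs_def])
next
  case (add x y)
  then show ?case using alternating_add by (simp add: rep_add[abs_def])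
next
  case (word c w)
  have "alternating s (foldr (act (\<lambda>u v. b u v / 2)) w g)"
  proof (induction w)
    case (Cons v w)
    then show ?case
      unfolding act_def foldr_Cons comp_apply
      by (intro alternating_add alternating_Cons alternating_contr) (simp_all add: add_divide_distrib)
  qed (simp add: assms)
  then show ?case using alternating_scale by (simp add: rep_scale[abs_def] rep_word)
qed

text \<open>Chevalley's action factors through the Clifford algebra. The relators annihilate
  alternating functionals, and right multiples \<open>x * a\<close> do so as well because
  \<open>rep_alternating\<close> keeps the result of \<open>a\<close> alternating. The existential
  ties the raw functions in \<open>cl_ideal\<close> to elements of \<open>falg\<close>.\<close>

lemma rep_cl_ideal:
  assumes "x \<in> cl_ideal s f"
  shows "\<exists>a. x = coef a \<and> (\<forall>g w. alternating s g \<longrightarrow> rep (\<lambda>u v. b u v / 2) a g w = 0)"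
  using assms
proof induction
  case (rel_add u v)
  let ?a = "gen (u + v) - (gen u + gen v) :: ('v, 'k) falg"
  have "rep (\<lambda>u v. b u v / 2) ?a g w = 0" if "alternating s g" for g w
  proof -
    have "g ((u + v) # w) = g (u # w) + g (v # w)"
      using that unfolding alternating_def by (metis append_Nil)
    then show ?thesis
      using contr_vec_add[of "\<lambda>u v. b u v / 2" u v g w]
      by (simp add: rep_diff rep_add rep_word act_def add_divide_distrib)
  qed
  then show ?case
    by (intro exI[of _ ?a]) (simp add: minus_falg.rep_eq plus_falg.rep_eq coef_gen)
next
  case (rel_scale c v)
  let ?a = "gen (s c v) - fsc c (gen v) :: ('v, 'k) falg"
  have "rep (\<lambda>u v. b u v / 2) ?a g w = 0" if "alternating s g" for g w
  proof -
    have "g (s c v # w) = c * g (v # w)"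
      using that unfolding alternating_def by (metis append_Nil)
    then show ?thesis
      using contr_vec_scale[of "\<lambda>u v. b u v / 2" s c v g w]
      by (simp add: rep_diff rep_scale rep_word act_def algebra_simps)
  qed
  then show ?case
    by (intro exI[of _ ?a]) (simp add: minus_falg.rep_eq fsc.rep_eq coef_gen)
next
  case (rel_square v)
  \<comment> \<open>The unit is written \<open>word []\<close> so that \<open>rep_word\<close>
    evaluates it as the identity operator.\<close>
  let ?a = "gen v * gen v - fsc (f v) (word []) :: ('v, 'k) falg"
  have "rep (\<lambda>u v. b u v / 2) ?a g w = 0" if "alternating s g" for g w
    using act_act[OF that, of "\<lambda>u v. b u v / 2" v w] two_neq_0
    by (simp add: rep_diff rep_scale rep_word rep_mult)
  then show ?case
    by (intro exI[of _ ?a])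
      (simp add: word_Nil minus_falg.rep_eq times_falg.rep_eq fsc.rep_eq one_falg.rep_eq coef_gen)
next
  case zero
  show ?case by (intro exI[of _ 0]) (simp add: zero_falg.rep_eq rep_zero)
next
  case (add x y)
  then obtain x' y' where "x = coef x'" "y = coef y'"
    "\<And>g w. alternating s g \<Longrightarrow> rep (\<lambda>u v. b u v / 2) x' g w = 0"
    "\<And>g w. alternating s g \<Longrightarrow> rep (\<lambda>u v. b u v / 2) y' g w = 0"
    by blast
  then show ?case
    by (intro exI[of _ "x' + y'"]) (simp add: plus_falg.rep_eq rep_add)
next
  case (scale x c)
  then obtain x' where "x = coef x'"
    "\<And>g w. alternating s g \<Longrightarrow> rep (\<lambda>u v. b u v / 2) x' g w = 0"
    by blast
  then show ?case
    by (intro exI[of _ "fsc c x'"]) (simp add: fsc.rep_eq rep_scale)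
next
  case (lmult x a)
  from lmult.hyps(2) obtain a' where a': "a = coef a'" by (rule coef_cases)
  from lmult.IH obtain x' where x': "x = coef x'"
    "\<And>g w. alternating s g \<Longrightarrow> rep (\<lambda>u v. b u v / 2) x' g w = 0"
    by blast
  have "rep (\<lambda>u v. b u v / 2) (a' * x') g w = 0" if "alternating s g" for g w
  proof -
    have "rep (\<lambda>u v. b u v / 2) x' g = (\<lambda>w. 0)" using x'(2)[OF that] by (intro ext)
    then show ?thesis by (simp add: rep_mult rep_fun_zero)
  qed
  with a' x' show ?case by (intro exI[of _ "a' * x'"]) (simp add: times_falg.rep_eq)
next
  case (rmult x a)
  from rmult.hyps(2) obtain a' where a': "a = coef a'" by (rule coef_cases)
  from rmult.IH obtain x' where "x = coef x'"
    "\<And>g w. alternating s g \<Longrightarrow> rep (\<lambda>u v. b u v / 2) x' g w = 0"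
    by blast
  with a' show ?case
    by (intro exI[of _ "x' * a'"]) (simp add: times_falg.rep_eq rep_mult rep_alternating)
qed

lemma one_notin_I: "1 \<notin> I"
proof
  assume "1 \<in> I"
  then have *: "rep (\<lambda>u v. b u v / 2) (word []) g w = 0" if "alternating s g" for g w
    using rep_cl_ideal[of "coef 1"] that by (auto simp: I_def coef_inject word_Nil)
  \<comment> \<open>Projection to degree zero is alternating; the unit fixes it, so its value 1 at
    the empty word contradicts the vanishing.\<close>
  have "alternating s (\<lambda>w. if w = [] then 1 else 0)"
    by (simp add: alternating_def)
  from *[OF this, of "[]"] show False by (simp add: rep_word)
qed

end

section \<open>Matrix units modulo the Clifford ideal\<close>

definition mat_map :: "nat \<Rightarrow> (nat \<Rightarrow> nat \<Rightarrow> ('v, 'k) falg) \<Rightarrow> (nat \<Rightarrow> nat \<Rightarrow> 'k::field) \<Rightarrow> ('v, 'k) falg" where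
  "mat_map N E X = (\<Sum>i<N. \<Sum>j<N. fsc (X i j) (E i j))"

lemma mat_map_add: "mat_map N E (mat_add X Y) = mat_map N E X + mat_map N E Y"
  by (simp add: mat_map_def mat_add_def falg.scale_left_distrib sum.distrib)

lemma mat_map_scale: "mat_map N E (mat_scale c X) = fsc c (mat_map N E X)"
  by (simp add: mat_map_def mat_scale_def falg.scale_sum_right)

lemma mat_map_one: "mat_map N E (mat_one N) = (\<Sum>i<N. E i i)"
proof -
  have "fsc (mat_one N i j) (E i j) = (if i = j then E i i else 0)" if "i < N" for i j
    using that by (simp add: mat_one_def)
  then show ?thesis unfolding mat_map_def by simp
qed

lemma mat_map_unit:
  assumes "p < N" "q < N"
  shows "mat_map N E (\<lambda>i j. if i = p \<and> j = q then 1 else 0) = E p q"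
proof -
  have "fsc (if i = p \<and> j = q then 1 else 0) (E i j) = (if i = p then if j = q then E p q else 0 else 0)" for i j
    by simp
  moreover have "(\<Sum>j<N. if i = p then if j = q then E p q else 0 else 0) = (if i = p then E p q else 0)" for i
    using assms by simp
  ultimately show ?thesis using assms unfolding mat_map_def by simp
qed

context clifford
begin

section \<open>Calculation modulo the Clifford ideal\<close>

definition ceq :: "('v, 'k) falg \<Rightarrow> ('v, 'k) falg \<Rightarrow> bool" (infix "\<simeq>" 50) where
  "x \<simeq> y \<longleftrightarrow> x - y \<in> I"

lemma ceq_refl [simp]: "x \<simeq> x"
  by (simp add: ceq_def)

lemma ceq_sym: "x \<simeq> y \<Longrightarrow> y \<simeq> x"
  unfolding ceq_def using I_uminus by fastforce

lemma ceq_trans [trans]: "x \<simeq> y \<Longrightarrow> y \<simeq> z \<Longrightarrow> x \<simeq> z"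
  unfolding ceq_def using I_add by fastforce

lemma ceq_eq_trans [trans]: "x \<simeq> y \<Longrightarrow> y = z \<Longrightarrow> x \<simeq> z"
  by simp

lemma eq_ceq_trans [trans]: "x = y \<Longrightarrow> y \<simeq> z \<Longrightarrow> x \<simeq> z"
  by simp

lemma ceq_add: "x \<simeq> y \<Longrightarrow> x' \<simeq> y' \<Longrightarrow> x + x' \<simeq> y + y'"
  unfolding ceq_def using I_add by (fastforce simp: algebra_simps)

lemma ceq_scale: "x \<simeq> y \<Longrightarrow> fsc c x \<simeq> fsc c y"
  unfolding ceq_def using I_scale by (fastforce simp: falg.scale_right_diff_distrib)

lemma ceq_mult:
  assumes "x \<simeq> y" "x' \<simeq> y'"
  shows "x * x' \<simeq> y * y'"
proof -
  have "x * x' - y * y' = (x - y) * x' + y * (x' - y')" by (simp add: algebra_simps)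
  then show ?thesis using assms by (simp add: ceq_def I_intros)
qed

lemma ceq_sum: "(\<And>i. i \<in> A \<Longrightarrow> g i \<simeq> h i) \<Longrightarrow> sum g A \<simeq> sum h A"
  unfolding ceq_def sum_subtractf[symmetric] by (rule I_sum)

lemma cl_eq_coef: "cl_eq s f (coef x) (coef y) \<longleftrightarrow> x \<simeq> y"
  by (simp add: cl_eq_def ceq_def I_def minus_falg.rep_eq)

text \<open>Linear independence modulo \<open>I\<close> follows from these relations together with
  \<open>1 \<notin> I\<close>; see \<open>mat_map_inj\<close>.\<close>

definition mat_units :: "nat \<Rightarrow> (nat \<Rightarrow> nat \<Rightarrow> ('v, 'k) falg) \<Rightarrow> bool" where
  "mat_units N E \<longleftrightarrow>
     (\<forall>i<N. \<forall>j<N. \<forall>k<N. \<forall>l<N. E i j * E k l \<simeq> (if j = k then E i l else 0)) \<and>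
     (\<Sum>i<N. E i i) \<simeq> 1"

lemma mat_units_mult:
  "mat_units N E \<Longrightarrow> i < N \<Longrightarrow> j < N \<Longrightarrow> k < N \<Longrightarrow> l < N \<Longrightarrow> E i j * E k l \<simeq> (if j = k then E i l else 0)"
  by (simp add: mat_units_def)

lemma mat_units_sum: "mat_units N E \<Longrightarrow> (\<Sum>i<N. E i i) \<simeq> 1"
  by (simp add: mat_units_def)

lemma mat_map_mult:
  assumes "mat_units N E"
  shows "mat_map N E X * mat_map N E Y \<simeq> mat_map N E (mat_mult N X Y)"
proof -
  have "mat_map N E X * mat_map N E Y
      = (\<Sum>i<N. \<Sum>j<N. \<Sum>k<N. \<Sum>l<N. fsc (X i j * Y k l) (E i j * E k l))"
    unfolding mat_map_def sum_distrib_right by (simp add: sum_distrib_left falg.scale_sum_right mult.commute[where 'a = 'k])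
  also have "\<dots> \<simeq> (\<Sum>i<N. \<Sum>j<N. \<Sum>k<N. \<Sum>l<N. fsc (X i j * Y k l) (if j = k then E i l else 0))"
    by (intro ceq_sum ceq_scale mat_units_mult[OF assms]) simp_all
  also have "(\<Sum>i<N. \<Sum>j<N. \<Sum>k<N. \<Sum>l<N. fsc (X i j * Y k l) (if j = k then E i l else 0))
      = (\<Sum>i<N. \<Sum>j<N. \<Sum>k<N. if j = k then \<Sum>l<N. fsc (X i j * Y j l) (E i l) else 0)"
    by (intro sum.cong refl) auto
  also have "\<dots> = (\<Sum>i<N. \<Sum>j<N. \<Sum>l<N. fsc (X i j * Y j l) (E i l))"
    by simp
  also have "\<dots> = (\<Sum>i<N. \<Sum>l<N. \<Sum>j<N. fsc (X i j * Y j l) (E i l))"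
    by (intro sum.cong refl sum.swap)
  also have "\<dots> = mat_map N E (mat_mult N X Y)"
    unfolding mat_map_def mat_mult_def by (simp add: falg.scale_sum_left)
  finally show ?thesis .
qed

text \<open>Simplicity of the full matrix algebra in explicit form: for the difference
  \<open>Z\<close>, the sandwiches \<open>E k p * mat_map N E Z * E q k\<close> reduce to
  \<open>fsc (Z p q) (E k k)\<close>, and summing over \<open>k\<close> puts \<open>Z p q\<close>
  times the unit into \<open>I\<close>, so \<open>1\<close> would lie in \<open>I\<close>.\<close>

lemma mat_map_inj:
  assumes mu: "mat_units N E" and XY: "mat_map N E X \<simeq> mat_map N E Y" and pq: "p < N" "q < N"
  shows "X p q = Y p q"
proof (rule ccontr)
  assume neq: "X p q \<noteq> Y p q"
  define Z where "Z = (\<lambda>i j. X i j - Y i j)"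
  have "mat_map N E Z = mat_map N E X - mat_map N E Y"
    by (simp add: mat_map_def Z_def falg.scale_left_diff_distrib sum_subtractf)
  then have Z: "mat_map N E Z \<in> I" using XY by (simp add: ceq_def)
  have "E k p * mat_map N E Z * E q k \<simeq> fsc (Z p q) (E k k)" if k: "k < N" for k
  proof -
    have "E k p * mat_map N E Z * E q k = (\<Sum>i<N. \<Sum>j<N. fsc (Z i j) (E k p * E i j * E q k))"
      unfolding mat_map_def by (simp add: sum_distrib_left sum_distrib_right)
    also have "\<dots> \<simeq> (\<Sum>i<N. \<Sum>j<N. if i = p then if j = q then fsc (Z p q) (E k k) else 0 else 0)"
    proof (intro ceq_sum)
      fix i j assume "i \<in> {..<N}" "j \<in> {..<N}"
      then have ij: "i < N" "j < N" by auto
      have 1: "E k p * E i j \<simeq> (if p = i then E k j else 0)"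
        and 2: "E k j * E q k \<simeq> (if j = q then E k k else 0)"
        using mat_units_mult[OF mu] ij pq k by blast+
      have "E k p * E i j * E q k \<simeq> (if p = i then E k j else 0) * E q k"
        by (intro ceq_mult 1) simp
      also have "\<dots> = (if p = i then E k j * E q k else 0)" by simp
      also have "\<dots> \<simeq> (if p = i then if j = q then E k k else 0 else 0)" using 2 by simp
      finally show "fsc (Z i j) (E k p * E i j * E q k)
          \<simeq> (if i = p then if j = q then fsc (Z p q) (E k k) else 0 else 0)"
        using ceq_scale[of "E k p * E i j * E q k" _ "Z i j"] by fastforce
    qed
    also have "(\<Sum>i<N. \<Sum>j<N. if i = p then if j = q then fsc (Z p q) (E k k) else 0 else 0)
        = (\<Sum>i<N. if i = p then fsc (Z p q) (E k k) else 0)"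
      using pq by (intro sum.cong refl) simp
    also have "\<dots> = fsc (Z p q) (E k k)" using pq by simp
    finally show ?thesis .
  qed
  then have "(\<Sum>k<N. E k p * mat_map N E Z * E q k) \<simeq> (\<Sum>k<N. fsc (Z p q) (E k k))"
    by (intro ceq_sum) simp
  also have "\<dots> = fsc (Z p q) (\<Sum>k<N. E k k)" by (simp add: falg.scale_sum_right)
  also have "\<dots> \<simeq> fsc (Z p q) 1" by (intro ceq_scale mat_units_sum[OF mu])
  finally have "fsc (Z p q) 1 - (\<Sum>k<N. E k p * mat_map N E Z * E q k) \<in> I"
    using ceq_sym ceq_def by blast
  moreover have "(\<Sum>k<N. E k p * mat_map N E Z * E q k) \<in> I"
    using Z by (intro I_intros) auto
  ultimately have "fsc (Z p q) 1 \<in> I" using I_add by fastforce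
  then have "fsc (inverse (Z p q)) (fsc (Z p q) 1) \<in> I" by (rule I_scale)
  then show False using neq one_notin_I by (simp add: Z_def)
qed

lemma cl_matrix_embedding_mat_map:
  assumes "mat_units N E" "0 < N"
  shows "cl_matrix_embedding s f N (\<lambda>X. coef (mat_map N E X))"
  unfolding cl_matrix_embedding_def
proof (intro conjI ballI allI impI)
  fix X Y :: "nat \<Rightarrow> nat \<Rightarrow> 'k" and c
  show "coef (mat_map N E X) \<in> fa_carrier" by (rule coef)
  show "cl_eq s f (coef (mat_map N E (mat_add X Y))) (fa_add (coef (mat_map N E X)) (coef (mat_map N E Y)))"
    by (simp add: plus_falg.rep_eq[symmetric] cl_eq_coef mat_map_add)
  show "cl_eq s f (coef (mat_map N E (mat_scale c X))) (fa_scale c (coef (mat_map N E X)))"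
    by (simp add: fsc.rep_eq[symmetric] cl_eq_coef mat_map_scale)
  show "cl_eq s f (coef (mat_map N E (mat_mult N X Y))) (fa_mult (coef (mat_map N E X)) (coef (mat_map N E Y)))"
    using mat_map_mult[OF assms(1), of X Y]
    by (simp add: times_falg.rep_eq[symmetric] cl_eq_coef ceq_sym)
  show "cl_eq s f (coef (mat_map N E (mat_one N))) fa_one"
    using assms(1) by (simp add: one_falg.rep_eq[symmetric] cl_eq_coef mat_map_one mat_units_def)
  assume X: "X \<in> mat_carrier N" and Y: "Y \<in> mat_carrier N"
    and eq: "cl_eq s f (coef (mat_map N E X)) (coef (mat_map N E Y))"
  show "X = Y"
  proof (intro ext)
    fix i j
    show "X i j = Y i j"
    proof (cases "i < N \<and> j < N")
      case True
      then show ?thesis using mat_map_inj[OF assms(1)] eq by (simp add: cl_eq_coef)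
    next
      case False
      then show ?thesis using X Y by (auto simp: mat_carrier_def)
    qed
  qed
qed (rule assms(2))

text \<open>The matrix \<open>X\<close> is arbitrary outside the \<open>N\<close> by
  \<open>N\<close> block, which \<open>mat_map\<close> never reads; \<open>mat_span_carrier\<close>
  truncates it when a member of \<open>mat_carrier\<close> is wanted.\<close>

definition mat_span :: "nat \<Rightarrow> (nat \<Rightarrow> nat \<Rightarrow> ('v, 'k) falg) \<Rightarrow> ('v, 'k) falg set" where
  "mat_span N E = {x. \<exists>X. x \<simeq> mat_map N E X}"

lemma mat_span_ceq: "x \<simeq> y \<Longrightarrow> y \<in> mat_span N E \<Longrightarrow> x \<in> mat_span N E"
  unfolding mat_span_def using ceq_trans by blast

lemma mat_span_add: "x \<in> mat_span N E \<Longrightarrow> y \<in> mat_span N E \<Longrightarrow> x + y \<in> mat_span N E"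
  by (force simp: mat_span_def mat_map_add[symmetric] dest: ceq_add)

lemma mat_span_scale: "x \<in> mat_span N E \<Longrightarrow> fsc c x \<in> mat_span N E"
  by (force simp: mat_span_def mat_map_scale[symmetric] dest: ceq_scale)

lemma mat_span_mult:
  "mat_units N E \<Longrightarrow> x \<in> mat_span N E \<Longrightarrow> y \<in> mat_span N E \<Longrightarrow> x * y \<in> mat_span N E"
  unfolding mat_span_def using ceq_mult mat_map_mult ceq_trans by blast

lemma mat_span_zero: "0 \<in> mat_span N E"
proof -
  have "0 \<simeq> mat_map N E (\<lambda>i j. 0)" by (simp add: mat_map_def)
  then show ?thesis unfolding mat_span_def by blast
qed

lemma mat_span_one: "mat_units N E \<Longrightarrow> 1 \<in> mat_span N E"
  by (auto simp: mat_span_def mat_units_def mat_map_one[symmetric] dest: ceq_sym)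

lemma mat_span_diff: "x \<in> mat_span N E \<Longrightarrow> y \<in> mat_span N E \<Longrightarrow> x - y \<in> mat_span N E"
  using mat_span_add[of x N E "fsc (- 1) y"] mat_span_scale[of y N E "- 1"] by simp

lemma mat_span_sum: "(\<And>i. i \<in> A \<Longrightarrow> g i \<in> mat_span N E) \<Longrightarrow> sum g A \<in> mat_span N E"
  by (induction A rule: infinite_finite_induct) (simp_all add: mat_span_zero mat_span_add)

lemma mat_span_unit: "i < N \<Longrightarrow> j < N \<Longrightarrow> E i j \<in> mat_span N E"
  unfolding mat_span_def mem_Collect_eq
  by (subst mat_map_unit[symmetric, of i N j E]) (auto intro: exI ceq_refl)

lemma mat_span_carrier:
  assumes "x \<in> mat_span N E"
  obtains X where "X \<in> mat_carrier N" "x \<simeq> mat_map N E X"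
proof -
  from assms obtain X where X: "x \<simeq> mat_map N E X" by (auto simp: mat_span_def)
  have "mat_map N E X = mat_map N E (\<lambda>i j. if i < N \<and> j < N then X i j else 0)"
    unfolding mat_map_def by (intro sum.cong refl) simp
  then show ?thesis
    using X by (intro that[of "\<lambda>i j. if i < N \<and> j < N then X i j else 0"]) (auto simp: mat_carrier_def)
qed

lemma mat_span_commute:
  assumes "x \<in> mat_span N E" and "\<And>i j. i < N \<Longrightarrow> j < N \<Longrightarrow> c * E i j \<simeq> E i j * c"
  shows "c * x \<simeq> x * c"
proof -
  from assms(1) obtain X where X: "x \<simeq> mat_map N E X" by (auto simp: mat_span_def)
  have "c * x \<simeq> c * mat_map N E X" by (intro ceq_mult X) simp
  also have "\<dots> = (\<Sum>i<N. \<Sum>j<N. fsc (X i j) (c * E i j))"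
    unfolding mat_map_def by (simp add: sum_distrib_left)
  also have "\<dots> \<simeq> (\<Sum>i<N. \<Sum>j<N. fsc (X i j) (E i j * c))"
    using assms(2) by (intro ceq_sum ceq_scale) simp
  also have "\<dots> = mat_map N E X * c"
    unfolding mat_map_def by (simp add: sum_distrib_right)
  also have "\<dots> \<simeq> x * c" by (intro ceq_mult ceq_sym[OF X]) simp
  finally show ?thesis .
qed

end

section \<open>Matrix units from hyperbolic pairs\<close>

lemma sum_lessThan_two: "(\<Sum>i<2. g i) = g 0 + g (1::nat)"
  by (simp add: numeral_2_eq_2)

lemma Suc_double_mod_two: "Suc (i * 2) mod 2 = Suc 0"
  by presburger

lemma sum_pair_block: "(\<Sum>i=m * 2..<m * 2 + 2. g i) = g (m * 2) + g (m * 2 + 1 :: nat)"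
  by (simp add: numeral_2_eq_2)

context clifford
begin

lemma mat_span_subset:
  assumes "\<And>i j. i < N \<Longrightarrow> j < N \<Longrightarrow> E i j \<in> mat_span M E'"
  shows "mat_span N E \<subseteq> mat_span M E'"
proof
  fix x assume "x \<in> mat_span N E"
  then obtain X where "x \<simeq> mat_map N E X" by (auto simp: mat_span_def)
  moreover have "mat_map N E X \<in> mat_span M E'"
    unfolding mat_map_def using assms by (intro mat_span_sum mat_span_scale) auto
  ultimately show "x \<in> mat_span M E'" by (rule mat_span_ceq)
qed

text \<open>The commutator with \<open>d\<close> is a derivation.\<close>

lemma commute_mult:
  assumes "d * p \<simeq> p * d" "d * q \<simeq> q * d"
  shows "d * (p * q) \<simeq> (p * q) * d"
proof -
  have "d * (p * q) - (p * q) * d = (d * p - p * d) * q + p * (d * q - q * d)"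
    by (simp add: algebra_simps)
  then show ?thesis using assms by (simp add: ceq_def I_intros)
qed

text \<open>Here \<open>a\<close> and \<open>c\<close> serve as the off-diagonal units. The
  relations give \<open>a * c * a \<simeq> a\<close> and \<open>c * a * c \<simeq> c\<close>, so
  \<open>a * c\<close> and \<open>c * a\<close> are complementary idempotents.\<close>

lemma mat_units_two:
  assumes aa: "a * a \<in> I" and cc: "c * c \<in> I" and ac: "a * c + c * a - 1 \<in> I"
  shows "mat_units 2 (\<lambda>k l. if k = 0 then if l = 0 then a * c else a else if l = 0 then c else c * a)"
    (is "mat_units 2 ?e")
proof -
  have aca: "a * c * a - a \<in> I"
  proof -
    have "a * c * a - a = a * (a * c + c * a - 1) - a * a * c" by (simp add: algebra_simps)
    then show ?thesis using assms by (simp add: I_intros)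
  qed
  have cac: "c * a * c - c \<in> I"
  proof -
    have "c * a * c - c = c * (a * c + c * a - 1) - c * c * a" by (simp add: algebra_simps)
    then show ?thesis using assms by (simp add: I_intros)
  qed
  have "a * c * (a * c) - a * c = (a * c * a - a) * c" by (simp add: algebra_simps)
  then have 1: "a * c * (a * c) - a * c \<in> I" using aca by (simp only: I_intros)
  have "c * a * (c * a) - c * a = (c * a * c - c) * a" by (simp add: algebra_simps)
  then have 2: "c * a * (c * a) - c * a \<in> I" using cac by (simp only: I_intros)
  have 3: "a * c * (c * a) \<in> I" using I_lmult[OF I_rmult[OF cc, of a], of a] by (simp add: mult.assoc)
  have 4: "c * a * (a * c) \<in> I" using I_lmult[OF I_rmult[OF aa, of c], of c] by (simp add: mult.assoc)
  have 5: "a * (a * c) \<in> I" "c * (c * a) \<in> I" "a * c * c \<in> I" "c * a * a \<in> I"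
    using I_rmult[OF aa, of c] I_rmult[OF cc, of a] I_lmult[OF aa, of c] I_lmult[OF cc, of a]
    by (simp_all add: mult.assoc)
  have "?e i j * ?e k l \<simeq> (if j = k then ?e i l else 0)"
    if "i < 2" "j < 2" "k < 2" "l < 2" for i j k l
  proof -
    have "i = 0 \<or> i = 1" "j = 0 \<or> j = 1" "k = 0 \<or> k = 1" "l = 0 \<or> l = 1" using that by auto
    then show ?thesis
      using aa cc aca cac 1 2 3 4 5
      by (elim disjE) (simp_all add: ceq_def mult.assoc)
  qed
  moreover have "(\<Sum>i<2. ?e i i) \<simeq> 1" using ac by (simp add: ceq_def numeral_2_eq_2)
  ultimately show ?thesis unfolding mat_units_def by blast
qed

text \<open>The Kronecker product of two systems of matrix units, the second of size 2.\<close>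

definition tensor :: "(nat \<Rightarrow> nat \<Rightarrow> ('v, 'k) falg) \<Rightarrow> (nat \<Rightarrow> nat \<Rightarrow> ('v, 'k) falg) \<Rightarrow> nat \<Rightarrow> nat \<Rightarrow> ('v, 'k) falg" where
  "tensor E e = (\<lambda>i j. E (i div 2) (j div 2) * e (i mod 2) (j mod 2))"

context
  fixes N E e
  assumes E: "mat_units N E" and e: "mat_units 2 e"
    and comm: "\<And>i j k l. i < N \<Longrightarrow> j < N \<Longrightarrow> k < 2 \<Longrightarrow> l < 2 \<Longrightarrow> e k l * E i j \<simeq> E i j * e k l"
begin

text \<open>Since the two systems commute, the middle factors of a product can be exchanged and the
  relations are checked in each factor separately.\<close>

lemma mat_units_tensor: "mat_units (N * 2) (tensor E e)"
proof -
  have "tensor E e i j * tensor E e k l \<simeq> (if j = k then tensor E e i l else 0)"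
    if "i < N * 2" "j < N * 2" "k < N * 2" "l < N * 2" for i j k l
  proof -
    have lt: "i div 2 < N" "j div 2 < N" "k div 2 < N" "l div 2 < N" using that by auto
    have lt2: "i mod 2 < 2" "j mod 2 < 2" "k mod 2 < 2" "l mod 2 < 2" by auto
    have jk: "j = k \<longleftrightarrow> j div 2 = k div 2 \<and> j mod 2 = k mod 2" by (metis div_mod_decomp)
    have "tensor E e i j * tensor E e k l
        = E (i div 2) (j div 2) * (e (i mod 2) (j mod 2) * E (k div 2) (l div 2)) * e (k mod 2) (l mod 2)"
      by (simp add: tensor_def mult.assoc)
    also have "\<dots> \<simeq> E (i div 2) (j div 2) * (E (k div 2) (l div 2) * e (i mod 2) (j mod 2)) * e (k mod 2) (l mod 2)"
      by (intro ceq_mult comm lt lt2 ceq_refl)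
    also have "\<dots> = (E (i div 2) (j div 2) * E (k div 2) (l div 2)) * (e (i mod 2) (j mod 2) * e (k mod 2) (l mod 2))"
      by (simp add: mult.assoc)
    also have "\<dots> \<simeq> (if j div 2 = k div 2 then E (i div 2) (l div 2) else 0)
        * (if j mod 2 = k mod 2 then e (i mod 2) (l mod 2) else 0)"
      by (intro ceq_mult mat_units_mult[OF E] mat_units_mult[OF e] lt lt2)
    also have "\<dots> = (if j = k then tensor E e i l else 0)" by (simp add: jk tensor_def)
    finally show ?thesis .
  qed
  moreover have "(\<Sum>i<N * 2. tensor E e i i) \<simeq> 1"
  proof -
    \<comment> \<open>The diagonal is grouped into blocks of indices \<open>m * 2\<close> and
      \<open>m * 2 + 1\<close>; each block sums to \<open>E m m\<close> times the identity of the
      second factor.\<close>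
    have "(\<Sum>i<N * 2. tensor E e i i) = (\<Sum>m<N. \<Sum>i=m * 2..<m * 2 + 2. tensor E e i i)"
      by (rule sum.nat_group[symmetric])
    also have "\<dots> = (\<Sum>m<N. E m m * (\<Sum>k<2. e k k))"
      by (intro sum.cong refl) (simp add: tensor_def Suc_double_mod_two sum_lessThan_two sum_pair_block distrib_left)
    also have "\<dots> \<simeq> (\<Sum>m<N. E m m * 1)"
      by (intro ceq_sum ceq_mult mat_units_sum[OF e] ceq_refl)
    also have "\<dots> \<simeq> 1" using mat_units_sum[OF E] by simp
    finally show ?thesis .
  qed
  ultimately show ?thesis unfolding mat_units_def by blast
qed

text \<open>Multiplying by the identity of the other factor, written as the sum of its diagonal
  units, expresses \<open>E i j\<close> through the product units. The other inclusion works in the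
  same way.\<close>

lemma mat_span_tensor_left: "mat_span N E \<subseteq> mat_span (N * 2) (tensor E e)"
proof (rule mat_span_subset)
  fix i j assume ij: "i < N" "j < N"
  have "E i j \<simeq> E i j * (\<Sum>k<2. e k k)"
    using ceq_mult[of "E i j" "E i j" 1 "\<Sum>k<2. e k k"] ceq_sym[OF mat_units_sum[OF e]] by simp
  also have "\<dots> = tensor E e (i * 2) (j * 2) + tensor E e (i * 2 + 1) (j * 2 + 1)"
    by (simp add: tensor_def Suc_double_mod_two sum_lessThan_two distrib_left)
  finally show "E i j \<in> mat_span (N * 2) (tensor E e)"
    using ij by (elim mat_span_ceq) (intro mat_span_add mat_span_unit, simp_all)
qed

lemma mat_span_tensor_right: "mat_span 2 e \<subseteq> mat_span (N * 2) (tensor E e)"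
proof (rule mat_span_subset)
  fix k l :: nat assume kl: "k < 2" "l < 2"
  have "e k l \<simeq> (\<Sum>i<N. E i i) * e k l"
    using ceq_mult[of 1 "\<Sum>i<N. E i i" "e k l" "e k l"] ceq_sym[OF mat_units_sum[OF E]] by simp
  also have "\<dots> = (\<Sum>i<N. tensor E e (i * 2 + k) (i * 2 + l))"
    using kl by (simp add: tensor_def sum_distrib_right)
  finally show "e k l \<in> mat_span (N * 2) (tensor E e)"
    using kl by (elim mat_span_ceq) (intro mat_span_sum mat_span_unit, simp_all)
qed

end

text \<open>Polarisation of the relation for squares at \<open>u + v\<close>.\<close>

lemma gen_anticommutator: "gen u * gen v + gen v * gen u - fsc (b u v) 1 \<in> I"
proof -
  have "(gen u + gen v) * (gen u + gen v) \<simeq> gen (u + v) * gen (u + v)"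
    using I_gen_add[of u v] by (intro ceq_mult) (auto simp: ceq_def dest: I_uminus)
  also have "\<dots> \<simeq> fsc (f (u + v)) 1" using I_gen_square by (simp add: ceq_def)
  finally have "(gen u + gen v) * (gen u + gen v) - fsc (f (u + v)) 1 \<in> I" by (simp add: ceq_def)
  moreover have "gen u * gen v + gen v * gen u - fsc (b u v) 1
     = ((gen u + gen v) * (gen u + gen v) - fsc (f (u + v)) 1)
       - (gen u * gen u - fsc (f u) 1) - (gen v * gen v - fsc (f v) 1)"
    by (simp add: f_add falg.scale_left_distrib algebra_simps)
  ultimately show ?thesis using I_gen_square by (simp only: I_diff)
qed

section \<open>Lists of hyperbolic pairs and their matrix units\<close>

definition vecs :: "('v \<times> 'v) list \<Rightarrow> 'v set" where
  "vecs ps = fst ` set ps \<union> snd ` set ps"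

definition perp :: "('v \<times> 'v) list \<Rightarrow> 'v \<Rightarrow> bool" where
  "perp ps v \<longleftrightarrow> (\<forall>u\<in>vecs ps. b v u = 0)"

text \<open>New pairs enter at the front and are orthogonal to all entries behind them; by symmetry
  of \<open>b\<close> the pairs are mutually orthogonal.\<close>

primrec hyperbolic :: "('v \<times> 'v) list \<Rightarrow> bool" where
  "hyperbolic [] = True"
| "hyperbolic (p # ps) = (hyperbolic ps \<and> perp ps (fst p) \<and> perp ps (snd p) \<and>
     f (fst p) = 0 \<and> f (snd p) = 0 \<and> b (fst p) (snd p) = 1)"

lemma vecs_simps [simp]: "vecs [] = {}" "vecs (p # ps) = {fst p, snd p} \<union> vecs ps"
  by (auto simp: vecs_def)

lemma finite_vecs: "finite (vecs ps)"
  by (simp add: vecs_def)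

lemma perp_simps [simp]:
  "perp [] v" "perp (p # ps) v \<longleftrightarrow> b v (fst p) = 0 \<and> b v (snd p) = 0 \<and> perp ps v"
  by (auto simp: perp_def)

text \<open>
  The bicommutant clause expresses that the matrix units lie in the algebra generated by \<open>W\<close>.
\<close>

definition graded_mat_units ::
    "('v, 'k) falg set \<Rightarrow> nat \<Rightarrow> (nat \<Rightarrow> nat \<Rightarrow> ('v, 'k) falg) \<Rightarrow> ('v, 'k) falg \<Rightarrow> bool" where
  "graded_mat_units W N E z \<longleftrightarrow>
     mat_units N E \<and> W \<subseteq> mat_span N E \<and>
     (\<forall>c. (\<forall>w\<in>W. c * w \<simeq> w * c) \<longrightarrow> (\<forall>i<N. \<forall>j<N. c * E i j \<simeq> E i j * c)) \<and>
     z \<in> mat_span N E \<and> z * z - 1 \<in> I \<and> (\<forall>w\<in>W. z * w + w * z \<in> I)"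

text \<open>Adjoins one hyperbolic pair \<open>x\<close>, \<open>y\<close>. The second conclusion
  passes on what the next pair requires: the new grading element still commutes with vectors
  orthogonal to everything so far.\<close>

lemma graded_mat_units_step:
  assumes "graded_mat_units W N E z"
    and xx: "x * x \<in> I" and yy: "y * y \<in> I" and xy: "x * y + y * x - 1 \<in> I"
    and zx: "z * x - x * z \<in> I" and zy: "z * y - y * z \<in> I"
    and xW: "\<And>w. w \<in> W \<Longrightarrow> x * w + w * x \<in> I" and yW: "\<And>w. w \<in> W \<Longrightarrow> y * w + w * y \<in> I"
  obtains E' z' where
    "graded_mat_units (insert x (insert y W)) (N * 2) E' z'"
    "\<And>w. z * w - w * z \<in> I \<Longrightarrow> x * w + w * x \<in> I \<Longrightarrow> y * w + w * y \<in> I \<Longrightarrow> z' * w - w * z' \<in> I"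
proof -
  have E: "mat_units N E" and zE: "z \<in> mat_span N E" and zz: "z * z - 1 \<in> I"
    and W: "\<And>w. w \<in> W \<Longrightarrow> w \<in> mat_span N E" "\<And>w. w \<in> W \<Longrightarrow> z * w + w * z \<in> I"
    and bicomm: "\<And>c i j. (\<And>w. w \<in> W \<Longrightarrow> c * w \<simeq> w * c) \<Longrightarrow> i < N \<Longrightarrow> j < N \<Longrightarrow> c * E i j \<simeq> E i j * c"
    using assms(1) unfolding graded_mat_units_def by blast+
  \<comment> \<open>Twisting by the grading element \<open>z\<close> makes \<open>x\<close> and \<open>y\<close>, which anticommute with \<open>W\<close>, commute with it.\<close>
  define a where "a = z * x"
  define c where "c = z * y"
  define e where "e = (\<lambda>(k::nat) (l::nat). if k = 0 then if l = 0 then a * c else a else if l = 0 then c else c * a)"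
  \<comment> \<open>In the new factor of size 2 this is the diagonal matrix with entries 1 and -1,
    its own grading element; the grading element of the enlarged algebra will be
    \<open>z * h\<close>.\<close>
  define h where "h = a * c - c * a"
  have aa: "a * a \<in> I"
  proof -
    have "a * a = z * z * (x * x) - z * (z * x - x * z) * x" by (simp add: a_def algebra_simps)
    then show ?thesis by (simp only: I_intros xx zx)
  qed
  have cc: "c * c \<in> I"
  proof -
    have "c * c = z * z * (y * y) - z * (z * y - y * z) * y" by (simp add: c_def algebra_simps)
    then show ?thesis by (simp only: I_intros yy zy)
  qed
  have ac: "a * c + c * a - 1 \<in> I"
  proof -
    have "a * c + c * a - 1 = z * z * (x * y + y * x - 1) + (z * z - 1)
        - z * (z * x - x * z) * y - z * (z * y - y * z) * x"
      by (simp add: a_def c_def algebra_simps)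
    then show ?thesis by (simp only: I_intros xy zz zx zy)
  qed
  have e: "mat_units 2 e" unfolding e_def using aa cc ac by (rule mat_units_two)
  have aW: "a * w \<simeq> w * a" if "w \<in> W" for w
  proof -
    have "a * w - w * a = z * (x * w + w * x) - (z * w + w * z) * x"
      by (simp add: a_def algebra_simps)
    then show ?thesis using that unfolding ceq_def by (simp only: I_intros xW W)
  qed
  have cW: "c * w \<simeq> w * c" if "w \<in> W" for w
  proof -
    have "c * w - w * c = z * (y * w + w * y) - (z * w + w * z) * y"
      by (simp add: c_def algebra_simps)
    then show ?thesis using that unfolding ceq_def by (simp only: I_intros yW W)
  qed
  have e_comm: "d * e k l \<simeq> e k l * d" if "d * a \<simeq> a * d" "d * c \<simeq> c * d" for d k l
    using that by (auto simp: e_def intro: commute_mult)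
  \<comment> \<open>Each \<open>e k l\<close> is built from \<open>a\<close> and \<open>c\<close>,
    which commute with \<open>W\<close>; the bicommutant clause extends this from \<open>W\<close>
    to all \<open>E i j\<close>.\<close>
  have comm: "e k l * E i j \<simeq> E i j * e k l" if "i < N" "j < N" for i j k l
    by (intro ceq_sym[OF e_comm] ceq_sym[OF bicomm] aW cW that)
  define E' where "E' = tensor E e"
  have E': "mat_units (N * 2) E'"
    unfolding E'_def by (rule mat_units_tensor[OF E e comm])
  have sub1: "mat_span N E \<subseteq> mat_span (N * 2) E'"
    unfolding E'_def by (rule mat_span_tensor_left[OF E e comm])
  have sub2: "mat_span 2 e \<subseteq> mat_span (N * 2) E'"
    unfolding E'_def by (rule mat_span_tensor_right[OF E e comm])
  have "e 0 1 \<in> mat_span 2 e" "e 1 0 \<in> mat_span 2 e" by (intro mat_span_unit; simp)+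
  then have acE: "a \<in> mat_span (N * 2) E'" "c \<in> mat_span (N * 2) E'"
    using sub2 by (auto simp: e_def)
  have zE': "z \<in> mat_span (N * 2) E'" using zE sub1 by blast
  have hE': "h \<in> mat_span (N * 2) E'"
    unfolding h_def by (intro mat_span_diff mat_span_mult E' acE)
  \<comment> \<open>Since \<open>z * z\<close> is 1 modulo \<open>I\<close>, the twist can be
    undone, and \<open>x\<close> and \<open>y\<close> lie in the enlarged matrix algebra.\<close>
  have xza: "x - z * a \<in> I"
  proof -
    have "x - z * a = - ((z * z - 1) * x)" by (simp add: a_def algebra_simps)
    then show ?thesis by (simp only: I_intros zz)
  qed
  have yzc: "y - z * c \<in> I"
  proof -
    have "y - z * c = - ((z * z - 1) * y)" by (simp add: c_def algebra_simps)
    then show ?thesis by (simp only: I_intros zz)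
  qed
  have za: "z * a - a * z \<in> I"
  proof -
    have "z * a - a * z = z * (z * x - x * z)" by (simp add: a_def algebra_simps)
    then show ?thesis by (simp only: I_intros zx)
  qed
  have zc: "z * c - c * z \<in> I"
  proof -
    have "z * c - c * z = z * (z * y - y * z)" by (simp add: c_def algebra_simps)
    then show ?thesis by (simp only: I_intros zy)
  qed
  have zh: "z * h - h * z \<in> I"
  proof -
    have "z * h - h * z = (z * a - a * z) * c + a * (z * c - c * z)
        - (z * c - c * z) * a - c * (z * a - a * z)"
      by (simp add: h_def algebra_simps)
    then show ?thesis by (simp only: I_intros za zc)
  qed
  have hh: "h * h - 1 \<in> I"
  proof -
    \<comment> \<open>The squares of \<open>a * c - c * a\<close> and \<open>a * c + c * a\<close>
      differ only by terms containing \<open>a * a\<close> or \<open>c * c\<close>.\<close>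
    have "h * h - 1 = (a * c + c * a - 1) * (a * c + c * a) + (a * c + c * a - 1)
        - a * (c * c) * a - a * (c * c) * a - c * (a * a) * c - c * (a * a) * c"
      by (simp add: h_def algebra_simps)
    then show ?thesis by (simp only: I_intros aa cc ac)
  qed
  have ha: "h * a + a * h \<in> I"
  proof -
    have "h * a + a * h = a * a * c - c * (a * a)" by (simp add: h_def algebra_simps)
    then show ?thesis by (simp only: I_intros aa)
  qed
  have hc: "h * c + c * h \<in> I"
  proof -
    have "h * c + c * h = a * (c * c) - c * c * a" by (simp add: h_def algebra_simps)
    then show ?thesis by (simp only: I_intros cc)
  qed
  define z' where "z' = z * h"
  have z'E': "z' \<in> mat_span (N * 2) E'" unfolding z'_def by (intro mat_span_mult E' zE' hE')
  have z'z': "z' * z' - 1 \<in> I"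
  proof -
    have "z' * z' - 1 = z * z * (h * h - 1) + (z * z - 1) - z * (z * h - h * z) * h"
      by (simp add: z'_def algebra_simps)
    then show ?thesis by (simp only: I_intros hh zz zh)
  qed
  \<comment> \<open>Replace \<open>x\<close> by \<open>z * a\<close>: modulo \<open>I\<close>,
    \<open>z\<close> commutes with \<open>a\<close> and \<open>h\<close>, while \<open>h\<close>
    anticommutes with \<open>a\<close>.\<close>
  have z'x: "z' * x + x * z' \<in> I"
  proof -
    have "z' * x + x * z' = z' * (x - z * a) + (x - z * a) * z'
        + z * z * (h * a + a * h) - z * (z * h - h * z) * a - z * (z * a - a * z) * h"
      by (simp add: z'_def algebra_simps)
    then show ?thesis by (simp only: I_intros xza ha zh za)
  qed
  have z'y: "z' * y + y * z' \<in> I"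
  proof -
    have "z' * y + y * z' = z' * (y - z * c) + (y - z * c) * z'
        + z * z * (h * c + c * h) - z * (z * h - h * z) * c - z * (z * c - c * z) * h"
      by (simp add: z'_def algebra_simps)
    then show ?thesis by (simp only: I_intros yzc hc zh zc)
  qed
  \<comment> \<open>On \<open>W\<close> the sign comes from \<open>z\<close>, because
    \<open>h\<close>, like \<open>a\<close> and \<open>c\<close>, commutes with
    \<open>W\<close>.\<close>
  have z'W: "z' * w + w * z' \<in> I" if "w \<in> W" for w
  proof -
    have "z' * w + w * z' = z * (a * (c * w - w * c) + (a * w - w * a) * c
        - c * (a * w - w * a) - (c * w - w * c) * a) + (z * w + w * z) * h"
      by (simp add: z'_def h_def algebra_simps)
    moreover have "a * w - w * a \<in> I" "c * w - w * c \<in> I" using aW cW that by (auto simp: ceq_def)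
    ultimately show ?thesis using that by (simp only: I_intros W)
  qed
  have xyE': "x \<in> mat_span (N * 2) E'" "y \<in> mat_span (N * 2) E'"
    using xza yzc mat_span_mult[OF E' zE'] acE by (auto intro: mat_span_ceq simp: ceq_def)
  \<comment> \<open>Preservation of the bicommutant clause: commuting with \<open>W\<close> gives
    commuting with all \<open>E i j\<close>, hence with \<open>z\<close> in their span, hence with
    \<open>a\<close> and \<open>c\<close>.\<close>
  have dE': "d * E' i j \<simeq> E' i j * d"
    if d: "\<forall>w\<in>insert x (insert y W). d * w \<simeq> w * d" and "i < N * 2" "j < N * 2" for d i j
  proof -
    have dE: "d * E i j \<simeq> E i j * d" if "i < N" "j < N" for i j
      using that d by (intro bicomm) auto
    have "d * z \<simeq> z * d" using zE dE by (rule mat_span_commute)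
    then have "d * a \<simeq> a * d" "d * c \<simeq> c * d"
      unfolding a_def c_def using d by (auto intro: commute_mult)
    then show ?thesis
      unfolding E'_def tensor_def using that(2,3) by (intro commute_mult dE e_comm) auto
  qed
  show thesis
  proof
    show "graded_mat_units (insert x (insert y W)) (N * 2) E' z'"
      unfolding graded_mat_units_def
      using E' z'E' z'z' xyE' W(1) sub1 dE' z'x z'y z'W by (intro conjI allI impI ballI) auto
    \<comment> \<open>Now \<open>a\<close> and \<open>c\<close> anticommute with \<open>w\<close>,
      so the quadratic expression \<open>h\<close> commutes with it, and so does
      \<open>z * h\<close>.\<close>
    show "z' * w - w * z' \<in> I"
      if "z * w - w * z \<in> I" "x * w + w * x \<in> I" "y * w + w * y \<in> I" for w
    proof -
      have "a * w + w * a = z * (x * w + w * x) - (z * w - w * z) * x"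
        by (simp add: a_def algebra_simps)
      then have 1: "a * w + w * a \<in> I" using that by (simp only: I_intros)
      have "c * w + w * c = z * (y * w + w * y) - (z * w - w * z) * y"
        by (simp add: c_def algebra_simps)
      then have 2: "c * w + w * c \<in> I" using that by (simp only: I_intros)
      have "z' * w - w * z' = z * (a * (c * w + w * c) - (a * w + w * a) * c
          - c * (a * w + w * a) + (c * w + w * c) * a) + (z * w - w * z) * h"
        by (simp add: z'_def h_def algebra_simps)
      then show ?thesis using that 1 2 by (simp only: I_intros)
    qed
  qed
qed

lemma gen_perp_anticommute: "b u v = 0 \<Longrightarrow> gen u * gen v + gen v * gen u \<in> I"
  using gen_anticommutator[of u v] by simp

lemma hyperbolic_mat_units:
  assumes "hyperbolic ps"
  shows "\<exists>E z. graded_mat_units (gen ` vecs ps) (2 ^ length ps) E z \<and>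
    (\<forall>v. perp ps v \<longrightarrow> z * gen v - gen v * z \<in> I)"
  using assms
proof (induction ps)
  case Nil
  \<comment> \<open>Without pairs the algebra consists of the scalars, and the grading element is
    1.\<close>
  have "mat_units 1 (\<lambda>i j. 1)" by (simp add: mat_units_def)
  then show ?case
    using mat_span_one by (intro exI[of _ "\<lambda>i j. 1"] exI[of _ 1]) (simp add: graded_mat_units_def)
next
  case (Cons p ps)
  let ?N = "2 ^ length ps" and ?x = "gen (fst p)" and ?y = "gen (snd p)"
  from Cons obtain E z where E: "graded_mat_units (gen ` vecs ps) ?N E z"
    and perp_z: "\<And>v. perp ps v \<Longrightarrow> z * gen v - gen v * z \<in> I"
    by auto
  have p: "perp ps (fst p)" "perp ps (snd p)" "f (fst p) = 0" "f (snd p) = 0" "b (fst p) (snd p) = 1"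
    using Cons.prems by simp_all
  have xx: "?x * ?x \<in> I" and yy: "?y * ?y \<in> I"
    using I_gen_square[of "fst p"] I_gen_square[of "snd p"] p by simp_all
  have xy: "?x * ?y + ?y * ?x - 1 \<in> I" using gen_anticommutator[of "fst p" "snd p"] p by simp
  have zxy: "z * ?x - ?x * z \<in> I" "z * ?y - ?y * z \<in> I" using perp_z p by blast+
  have W: "?x * w + w * ?x \<in> I" "?y * w + w * ?y \<in> I" if "w \<in> gen ` vecs ps" for w
    using that p(1,2) gen_perp_anticommute by (auto simp: perp_def)
  obtain E' z' where
    E': "graded_mat_units (insert ?x (insert ?y (gen ` vecs ps))) (?N * 2) E' z'"
    "\<And>w. z * w - w * z \<in> I \<Longrightarrow> ?x * w + w * ?x \<in> I \<Longrightarrow> ?y * w + w * ?y \<in> I \<Longrightarrow> z' * w - w * z' \<in> I"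
    using graded_mat_units_step[OF E xx yy xy zxy W] by blast
  have "z' * gen v - gen v * z' \<in> I" if "perp (p # ps) v" for v
    using that by (intro E'(2) perp_z gen_perp_anticommute) (simp_all add: b_sym)
  then show ?case
    using E'(1) by (intro exI[of _ E'] exI[of _ z']) (simp add: mult.commute)
qed

end

section \<open>Hyperbolic subspaces\<close>

text \<open>The added hypotheses supply hyperbolic pairs: they give square roots, vectors outside
  finite-dimensional subspaces, and vectors pairing nontrivially with a given nonzero one.\<close>

locale nondegenerate_clifford = clifford s f
  for s :: "'k::field \<Rightarrow> 'v::ab_group_add \<Rightarrow> 'v" and f :: "'v \<Rightarrow> 'k" +
  assumes closed: "alg_closed TYPE('k)"
    and infinite_dim: "infinite_dimensional s"
    and nondegenerate: "nondegenerate_qf f"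
begin

lemma sqrt_exists: "\<exists>t. t\<^sup>2 = (c::'k)"
proof -
  have "degree [:- c, 0, 1:] > 0" by simp
  then obtain t where "poly [:- c, 0, 1:] t = 0"
    using closed unfolding alg_closed_def by blast
  then show ?thesis by (intro exI[of _ t]) (simp add: power2_eq_square)
qed

lemma perp_add: "perp ps u \<Longrightarrow> perp ps v \<Longrightarrow> perp ps (u + v)"
  by (simp add: perp_def)

lemma perp_scale: "perp ps v \<Longrightarrow> perp ps (s c v)"
  by (simp add: perp_def)

lemma perp_diff: "perp ps u \<Longrightarrow> perp ps v \<Longrightarrow> perp ps (u - v)"
  by (simp add: perp_def)

lemma perp_span:
  assumes "perp ps u" "w \<in> span (vecs ps)"
  shows "b u w = 0"
  using assms(2)
proof (induction rule: span_induct_alt)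
  case (step c x y)
  then show ?case using assms(1) by (simp add: perp_def)
qed simp

text \<open>Orthogonal projection along a hyperbolic subspace, one pair at a time as in
  Gram-Schmidt.\<close>

lemma perp_projection:
  assumes "hyperbolic ps"
  shows "\<exists>v'. perp ps v' \<and> v - v' \<in> span (vecs ps)"
  using assms
proof (induction ps)
  case Nil
  show ?case by (intro exI[of _ v]) (simp add: span_zero)
next
  case (Cons p ps)
  then obtain v' where v': "perp ps v'" "v - v' \<in> span (vecs ps)" by auto
  let ?x = "fst p" and ?y = "snd p"
  \<comment> \<open>The coefficient of \<open>?x\<close> is read off with \<open>?y\<close> and
    conversely, since both are isotropic and pair to 1.\<close>
  let ?v = "v' - s (b v' ?y) ?x - s (b v' ?x) ?y"
  have "b ?y ?x = 1" using Cons.prems by (simp add: b_sym)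
  then have "perp (p # ps) ?v"
    using Cons.prems v' by (simp add: perp_diff perp_scale)
  moreover have "v - ?v \<in> span (vecs (p # ps))"
  proof -
    have "v - ?v = (v - v') + (s (b v' ?y) ?x + s (b v' ?x) ?y)" by simp
    moreover have "v - v' \<in> span (vecs (p # ps))"
      using v'(2) span_mono[of "vecs ps" "vecs (p # ps)"] by auto
    moreover have "s (b v' ?y) ?x + s (b v' ?x) ?y \<in> span (vecs (p # ps))"
      by (intro span_add span_scale span_base) auto
    ultimately show ?thesis by (metis span_add)
  qed
  ultimately show ?case by blast
qed

text \<open>A vector \<open>w\<close> pairing with \<open>u\<close> can be projected to the
  complement of the pairs without changing \<open>b u w\<close>, as \<open>u\<close> is orthogonal
  to the removed part.\<close>

lemma perp_nondegenerate:
  assumes "hyperbolic ps" "perp ps u" "u \<noteq> 0"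
  obtains v where "perp ps v" "b u v \<noteq> 0"
proof -
  from assms(3) obtain w where w: "b u w \<noteq> 0"
    using nondegenerate unfolding nondegenerate_qf_def by blast
  obtain v where v: "perp ps v" "w - v \<in> span (vecs ps)"
    using perp_projection[OF assms(1)] by blast
  have "b u (w - v) = 0" using assms(2) v(2) by (rule perp_span)
  with w v(1) show ?thesis by (intro that[of v]) auto
qed

lemma not_in_finite_span:
  assumes "finite S"
  obtains v where "v \<notin> span S"
  using infinite_dim assms unfolding infinite_dimensional_def by blast

lemma hyperbolic_extend_isotropic:
  assumes ps: "hyperbolic ps" "perp ps u" "u \<noteq> 0" and "f u = 0"
  obtains v where "hyperbolic ((u, v) # ps)"
proof -
  obtain w where w: "perp ps w" "b u w \<noteq> 0" by (rule perp_nondegenerate[OF ps])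
  define w' where "w' = s (inverse (b u w)) w"
  have w': "perp ps w'" "b u w' = 1" using w by (simp_all add: w'_def perp_scale)
  \<comment> \<open>Subtracting a multiple \<open>t\<close> of the isotropic \<open>u\<close> lowers
    \<open>f w'\<close> by \<open>t * b w' u = t\<close>, so \<open>t = f w'\<close> makes the
    result isotropic.\<close>
  define v where "v = w' - s (f w') u"
  have "perp ps v" "b u v = 1" "f v = 0"
    using w' ps assms(4)
    by (simp_all add: v_def perp_diff perp_scale f_diff b_sym[of w' u])
  then show ?thesis using assms by (intro that[of v]) simp
qed

text \<open>Projecting a vector outside the span of \<open>u\<close> and the pairs gives a nonzero
  \<open>q\<close> orthogonal to both. If \<open>q\<close> and a partner \<open>w'\<close> pairing
  with it are both isotropic, then \<open>f (q + w') = b q w'\<close> is nonzero.\<close>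

lemma anisotropic_in_perp:
  assumes ps: "hyperbolic ps" "perp ps u" and fu: "f u \<noteq> 0"
  obtains q where "perp ps q" "b u q = 0" "f q \<noteq> 0"
proof -
  define P where "P = (\<lambda>v. v - s (b u v / (2 * f u)) u)"
  have P: "perp ps (P v)" "b u (P v) = 0" if "perp ps v" for v
    using that ps fu two_neq_0 by (simp_all add: P_def perp_diff perp_scale)
  obtain v where v: "v \<notin> span (insert u (vecs ps))"
    using not_in_finite_span finite_vecs by (meson finite_insert)
  obtain v' where v': "perp ps v'" "v - v' \<in> span (vecs ps)" using perp_projection[OF ps(1)] by blast
  define q where "q = P v'"
  have q: "perp ps q" "b u q = 0" using P v' by (simp_all add: q_def)
  have "q \<noteq> 0"
  proof
    assume "q = 0"
    then have "v = (v - v') + s (b u v' / (2 * f u)) u" by (simp add: q_def P_def)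
    moreover have "v - v' \<in> span (insert u (vecs ps))" using v'(2) span_mono by blast
    moreover have "s (b u v' / (2 * f u)) u \<in> span (insert u (vecs ps))"
      by (intro span_scale span_base) simp
    ultimately show False using v by (metis span_add)
  qed
  then obtain w where w: "perp ps w" "b q w \<noteq> 0" by (rule perp_nondegenerate[OF ps(1) q(1)])
  define w' where "w' = P w"
  have w': "perp ps w'" "b u w' = 0" "b q w' \<noteq> 0"
    using P w q(2) by (simp_all add: w'_def) (simp add: P_def b_sym)
  show ?thesis
  proof (cases "f q = 0 \<and> f w' = 0")
    case True
    then show ?thesis using q w' by (intro that[of "q + w'"]) (simp_all add: perp_add f_add)
  next
    case False
    then show ?thesis using that q w' by blast
  qed
qed

text \<open>By a square root in \<open>F\<close>, the orthogonal vector \<open>q\<close> is rescaled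
  to \<open>r\<close> with \<open>f r = - f u\<close>; then \<open>u + r\<close> and
  \<open>u - r\<close> are isotropic and span a plane containing \<open>u\<close>.\<close>

lemma hyperbolic_extend_anisotropic:
  assumes ps: "hyperbolic ps" "perp ps u" and fu: "f u \<noteq> 0"
  obtains p where "hyperbolic (p # ps)" "u \<in> span {fst p, snd p}"
proof -
  obtain q where q: "perp ps q" "b u q = 0" "f q \<noteq> 0" by (rule anisotropic_in_perp[OF assms])
  obtain t where t: "t\<^sup>2 = - f u / f q" using sqrt_exists by blast
  define r where "r = s t q"
  have r: "perp ps r" "b u r = 0" "b r u = 0" "f r = - f u"
    using q t by (simp_all add: r_def perp_scale b_sym[of q u])
  define x where "x = u + r"
  \<comment> \<open>The factor normalises \<open>b x y\<close> to 1, since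
    \<open>b (u + r) (u - r) = 2 * f u - 2 * f r = 4 * f u\<close>.\<close>
  define y where "y = s (1 / (4 * f u)) (u - r)"
  have four: "(4::'k) \<noteq> 0"
  proof -
    have "(4::'k) = 2 * 2" by simp
    then show ?thesis using two_neq_0 by (metis mult_eq_0_iff)
  qed
  have "perp ps x" "perp ps y" "f x = 0" "f y = 0"
    using r ps by (simp_all add: x_def y_def perp_add perp_diff perp_scale f_add f_diff)
  moreover have "b x y = 1"
    using r fu four by (simp add: x_def y_def)
  ultimately have "hyperbolic ((x, y) # ps)" using ps by simp
  moreover have "u \<in> span {x, y}"
  proof -
    have "s (1 / 2) x + s (2 * f u) y = s (1 / 2) (u + r) + s (2 * f u / (4 * f u)) (u - r)"
      by (simp add: x_def y_def)
    also have "2 * f u / (4 * f u) = 1 / 2" using fu four two_neq_0 by (simp add: field_simps)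
    also have "s (1 / 2) (u + r) + s (1 / 2) (u - r) = s (1 / 2 + 1 / 2) u"
      unfolding scale_right_distrib scale_right_diff_distrib scale_left_distrib by simp
    also have "(1 / 2 + 1 / 2 :: 'k) = 1" using two_neq_0 by (simp add: field_simps)
    finally have "u = s (1 / 2) x + s (2 * f u) y" by simp
    moreover have "s (1 / 2) x + s (2 * f u) y \<in> span {x, y}"
      by (intro span_add span_scale span_base) auto
    ultimately show ?thesis by metis
  qed
  ultimately show ?thesis by (intro that[of "(x, y)"]) auto
qed

lemma hyperbolic_extend_perp:
  assumes ps: "hyperbolic ps" "perp ps u" "u \<noteq> 0"
  obtains p where "hyperbolic (p # ps)" "u \<in> span {fst p, snd p}"
proof (cases "f u = 0")
  case True
  then obtain v where "hyperbolic ((u, v) # ps)" by (rule hyperbolic_extend_isotropic[OF ps])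
  then show ?thesis by (intro that[of "(u, v)"]) (auto intro: span_base)
next
  case False
  then show ?thesis using that by (rule hyperbolic_extend_anisotropic[OF ps(1,2)])
qed

section \<open>Finite subsets inside matrix algebras\<close>

lemma hyperbolic_extend:
  assumes "hyperbolic ps"
  obtains qs where "hyperbolic qs" "vecs ps \<subseteq> vecs qs" "u \<in> span (vecs qs)"
proof -
  obtain u' where u': "perp ps u'" "u - u' \<in> span (vecs ps)" using perp_projection[OF assms] by blast
  show ?thesis
  proof (cases "u' = 0")
    case True
    then show ?thesis using u' assms by (intro that[of ps]) auto
  next
    case False
    then obtain p where p: "hyperbolic (p # ps)" "u' \<in> span {fst p, snd p}"
      by (rule hyperbolic_extend_perp[OF assms u'(1)])
    have "u - u' \<in> span (vecs (p # ps))" "u' \<in> span (vecs (p # ps))"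
      using u'(2) p(2) span_mono[of "vecs ps" "vecs (p # ps)"] span_mono[of "{fst p, snd p}" "vecs (p # ps)"]
      by auto
    then have "u \<in> span (vecs (p # ps))" using span_add by fastforce
    then show ?thesis using p by (intro that[of "p # ps"]) auto
  qed
qed

lemma hyperbolic_contains_finite:
  assumes "finite S"
  shows "\<exists>ps. hyperbolic ps \<and> S \<subseteq> span (vecs ps)"
  using assms
proof induction
  case empty
  show ?case by (intro exI[of _ "[]"]) simp
next
  case (insert u S)
  then obtain ps where ps: "hyperbolic ps" "S \<subseteq> span (vecs ps)" by blast
  obtain qs where "hyperbolic qs" "vecs ps \<subseteq> vecs qs" "u \<in> span (vecs qs)"
    by (rule hyperbolic_extend[OF ps(1)])
  then show ?case using ps span_mono by (intro exI[of _ qs]) blast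
qed

text \<open>Gives matrix algebras of every size \<open>2 ^ m\<close>, hence the infinite exponent at
  2.\<close>

lemma hyperbolic_of_length: "\<exists>ps. hyperbolic ps \<and> length ps = m"
proof (induction m)
  case 0
  show ?case by (intro exI[of _ "[]"]) simp
next
  case (Suc m)
  then obtain ps where ps: "hyperbolic ps" "length ps = m" by blast
  obtain v where v: "v \<notin> span (vecs ps)" using not_in_finite_span[OF finite_vecs] by blast
  obtain u where u: "perp ps u" "v - u \<in> span (vecs ps)" using perp_projection[OF ps(1)] by blast
  then have "u \<noteq> 0" using v by auto
  then obtain p where "hyperbolic (p # ps)" using hyperbolic_extend_perp[OF ps(1) u(1)] by blast
  then show ?case using ps by (intro exI[of _ "p # ps"]) simp
qed

lemma finite_subset_mat_span:
  assumes "finite T"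
  obtains m E where "mat_units (2 ^ m) E" "T \<subseteq> mat_span (2 ^ m) E"
proof -
  \<comment> \<open>All letters occurring in the elements of \<open>T\<close>; a hyperbolic subspace
    containing them suffices.\<close>
  define L where "L = (\<Union>a\<in>T. \<Union>w\<in>{w. coef a w \<noteq> 0}. set w)"
  have "finite L" unfolding L_def using assms falg_word_expansion(1) by blast
  then obtain ps where ps: "hyperbolic ps" "L \<subseteq> span (vecs ps)" using hyperbolic_contains_finite by blast
  let ?N = "2 ^ length ps"
  obtain E z where "graded_mat_units (gen ` vecs ps) ?N E z"
    using hyperbolic_mat_units[OF ps(1)] by blast
  then have E: "mat_units ?N E" and vE: "gen ` vecs ps \<subseteq> mat_span ?N E"
    by (simp_all add: graded_mat_units_def)
  \<comment> \<open>The linearity relations of the Clifford ideal carry membership from the vectors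
    of the pairs to their linear span.\<close>
  have "subspace {v. gen v \<in> mat_span ?N E}"
  proof (rule subspaceI)
    show "0 \<in> {v. gen v \<in> mat_span ?N E}"
      using mat_span_ceq[OF _ mat_span_zero] I_gen_scale[of 0 0] by (simp add: ceq_def)
    show "x + y \<in> {v. gen v \<in> mat_span ?N E}"
      if "x \<in> {v. gen v \<in> mat_span ?N E}" "y \<in> {v. gen v \<in> mat_span ?N E}" for x y
      using that mat_span_ceq[OF _ mat_span_add] I_gen_add[of x y] by (simp add: ceq_def)
    show "s c x \<in> {v. gen v \<in> mat_span ?N E}" if "x \<in> {v. gen v \<in> mat_span ?N E}" for c x
      using that mat_span_ceq[OF _ mat_span_scale] I_gen_scale[of c x] by (simp add: ceq_def)
  qed
  then have "span (vecs ps) \<subseteq> {v. gen v \<in> mat_span ?N E}"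
    using vE by (intro span_minimal) auto
  then have gen: "gen v \<in> mat_span ?N E" if "v \<in> span (vecs ps)" for v using that by blast
  have word: "word w \<in> mat_span ?N E" if "set w \<subseteq> span (vecs ps)" for w
    using that
  proof (induction w)
    case Nil
    show ?case using mat_span_one[OF E] by (simp add: word_Nil)
  next
    case (Cons v w)
    then show ?case unfolding word_Cons[of v w] by (intro mat_span_mult[OF E] gen) auto
  qed
  have "a \<in> mat_span ?N E" if "a \<in> T" for a
  proof -
    have "set w \<subseteq> span (vecs ps)" if "coef a w \<noteq> 0" for w
      using that \<open>a \<in> T\<close> ps(2) by (auto simp: L_def)
    then have "(\<Sum>w | coef a w \<noteq> 0. fsc (coef a w) (word w)) \<in> mat_span ?N E"
      by (intro mat_span_sum mat_span_scale word) auto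
    then show ?thesis by (simp only: falg_word_expansion(2)[symmetric])
  qed
  with E show ?thesis using that by blast
qed

lemma locally_matrix: "clifford_locally_matrix s f"
  unfolding clifford_locally_matrix_def
proof (intro allI impI)
  fix S :: "('v list \<Rightarrow> 'k) set" assume S: "S \<subseteq> fa_carrier \<and> finite S"
  then obtain m E where E: "mat_units (2 ^ m) E" "Falg ` S \<subseteq> mat_span (2 ^ m) E"
    using finite_subset_mat_span[of "Falg ` S"] by blast
  have "\<exists>X\<in>mat_carrier (2 ^ m). cl_eq s f a (coef (mat_map (2 ^ m) E X))" if "a \<in> S" for a
  proof -
    from that E(2) have "Falg a \<in> mat_span (2 ^ m) E" by blast
    then obtain X where "X \<in> mat_carrier (2 ^ m)" "Falg a \<simeq> mat_map (2 ^ m) E X"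
      by (rule mat_span_carrier)
    moreover have "coef (Falg a) = a" using that S by (intro Falg_inverse) blast
    ultimately show ?thesis using cl_eq_coef[of "Falg a"] by auto
  qed
  then show "\<exists>n \<phi>. cl_matrix_embedding s f n \<phi> \<and> (\<forall>a\<in>S. \<exists>X\<in>mat_carrier n. cl_eq s f a (\<phi> X))"
    using cl_matrix_embedding_mat_map[OF E(1)]
    by (intro exI[of _ "2 ^ m"] exI[of _ "\<lambda>X. coef (mat_map (2 ^ m) E X)"]) simp
qed

lemma two_power_in_D: "2 ^ m \<in> clifford_D s f"
proof -
  obtain ps where "hyperbolic ps" "length ps = m" using hyperbolic_of_length by blast
  then obtain E z where "graded_mat_units (gen ` vecs ps) (2 ^ m) E z"
    using hyperbolic_mat_units by blast
  then have "mat_units (2 ^ m) E" by (simp add: graded_mat_units_def)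
  then show ?thesis unfolding clifford_D_def using cl_matrix_embedding_mat_map by fastforce
qed

end

section \<open>Divisibility of the sizes of matrix subalgebras\<close>

text \<open>A module over the \<open>n\<close> by \<open>n\<close> matrices is a direct sum of
  \<open>n\<close> copies of the image of \<open>e 0 0\<close>: for a basis \<open>B\<close> of this
  image, the vectors \<open>e i 0 x\<close> with \<open>x \<in> B\<close> form a basis of
  \<open>U\<close>.\<close>

lemma (in vector_space) matrix_units_dvd_dim:
  fixes e :: "nat \<Rightarrow> nat \<Rightarrow> 'b \<Rightarrow> 'b"
  assumes n: "0 < n" and U: "subspace U" and fin: "finite A" "U \<subseteq> span A"
    and add: "\<And>i j x y. e i j (x + y) = e i j x + e i j y"
    and scale: "\<And>i j c x. e i j (scale c x) = scale c (e i j x)"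
    and closed: "\<And>i j x. i < n \<Longrightarrow> j < n \<Longrightarrow> x \<in> U \<Longrightarrow> e i j x \<in> U"
    and mult: "\<And>i j k l x. i < n \<Longrightarrow> j < n \<Longrightarrow> k < n \<Longrightarrow> l < n \<Longrightarrow> x \<in> U \<Longrightarrow>
        e i j (e k l x) = (if j = k then e i l x else 0)"
    and one: "\<And>x. x \<in> U \<Longrightarrow> (\<Sum>i<n. e i i x) = x"
  shows "n dvd dim U"
proof -
  have zero: "e i j 0 = 0" for i j using scale[of i j 0 0] by simp
  have sum: "e i j (sum g K) = (\<Sum>x\<in>K. e i j (g x))" for i j and g :: "'c \<Rightarrow> 'b" and K
    by (induction K rule: infinite_finite_induct) (simp_all add: zero add)
  obtain B where B: "B \<subseteq> e 0 0 ` U" "independent B" "e 0 0 ` U \<subseteq> span B" "card B = dim (e 0 0 ` U)"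
    by (rule basis_exists)
  have BU: "x \<in> U" "e 0 0 x = x" if xB: "x \<in> B" for x
  proof -
    obtain y where "y \<in> U" "x = e 0 0 y" using B(1) xB by blast
    then show "x \<in> U" "e 0 0 x = x" using closed n by (simp_all add: mult)
  qed
  have "B \<subseteq> span A" using BU fin(2) by blast
  then have finB: "finite B" using independent_span_bound[OF fin(1) B(2)] by blast
  have zB: "0 \<notin> B" using B(2) dependent_zero by blast
  define h where "h = (\<lambda>(i, x). e i 0 x)"
  let ?I = "{..<n} \<times> B"
  \<comment> \<open>The operator \<open>e 0 k\<close> recovers the \<open>k\<close>-th copy and
    annihilates the others; this yields injectivity and independence.\<close>
  have e_h: "e 0 k (h (i, x)) = (if k = i then x else 0)" if "k < n" "i < n" "x \<in> B" for k i x
    using that n BU by (simp add: h_def mult)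
  have inj: "inj_on h ?I"
  proof (rule inj_onI)
    fix p q assume pq: "p \<in> ?I" "q \<in> ?I" "h p = h q"
    obtain i x k y where p: "p = (i, x)" "q = (k, y)" by fastforce
    have "e 0 i (h (i, x)) = e 0 i (h (k, y))" using pq p by simp
    \<comment> \<open>For \<open>i \<noteq> k\<close> this reads \<open>x = 0\<close>, which
      \<open>zB\<close> excludes.\<close>
    then have "x = (if i = k then y else 0)" using pq p e_h[of i i x] e_h[of i k y] by auto
    then show "p = q" using pq p zB by (auto split: if_splits)
  qed
  have "independent (h ` ?I)"
  proof
    assume "dependent (h ` ?I)"
    then obtain u where u: "\<exists>v\<in>h ` ?I. u v \<noteq> 0" "(\<Sum>v\<in>h ` ?I. scale (u v) v) = 0"
      using dependent_finite[of "h ` ?I"] finB by auto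
    then obtain k y where ky: "k < n" "y \<in> B" "u (h (k, y)) \<noteq> 0" by auto
    have "0 = e 0 k (\<Sum>v\<in>h ` ?I. scale (u v) v)" by (simp add: u zero)
    also have "\<dots> = (\<Sum>p\<in>?I. scale (u (h p)) (e 0 k (h p)))"
      by (simp add: sum.reindex[OF inj] sum scale)
    also have "\<dots> = (\<Sum>i<n. \<Sum>x\<in>B. scale (u (h (i, x))) (e 0 k (h (i, x))))"
      by (simp add: sum.cartesian_product split_def)
    also have "\<dots> = (\<Sum>i<n. if k = i then \<Sum>x\<in>B. scale (u (h (k, x))) x else 0)"
      using ky by (intro sum.cong refl) (auto simp: e_h)
    also have "\<dots> = (\<Sum>x\<in>B. scale (u (h (k, x))) x)" using ky by simp
    finally have "dependent B"
      using dependent_finite[OF finB] ky by (intro iffD2[OF dependent_finite[OF finB]] exI[of _ "\<lambda>x. u (h (k, x))"]) auto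
    then show False using B(2) by blast
  qed
  moreover have "h ` ?I \<subseteq> U" using closed BU n by (auto simp: h_def)
  moreover have "U \<subseteq> span (h ` ?I)"
  proof
    fix x assume x: "x \<in> U"
    have "e i i x \<in> span (h ` ?I)" if i: "i < n" for i
    proof -
      have sp: "e i 0 y \<in> span (h ` ?I)" if "y \<in> span B" for y
        using that
      proof (induction rule: span_induct_alt)
        case base
        show ?case by (simp add: zero span_zero)
      next
        case (step c y z)
        have "e i 0 y \<in> h ` ?I" using step(1) i by (auto simp: h_def image_iff)
        then show ?case using step by (simp add: add scale span_add span_scale span_base)
      qed
      \<comment> \<open>The component \<open>e i i x\<close> equals \<open>e i 0 (e 0 i x)\<close>,
        with the inner vector in the image of \<open>e 0 0\<close>.\<close>
      have "e 0 i x = e 0 0 (e 0 i x)" using x i n by (simp add: mult)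
      then have "e 0 i x \<in> span B" using B(3) closed[OF n i x] by blast
      then have "e i 0 (e 0 i x) \<in> span (h ` ?I)" by (rule sp)
      then show ?thesis using x i n by (simp add: mult)
    qed
    then have "(\<Sum>i<n. e i i x) \<in> span (h ` ?I)" by (intro span_sum) simp
    then show "x \<in> span (h ` ?I)" using one[OF x] by simp
  qed
  ultimately have "card (h ` ?I) = dim U" by (intro basis_card_eq_dim)
  then have "dim U = n * card B" by (simp add: card_image[OF inj] card_cartesian_product)
  then show ?thesis by simp
qed

text \<open>The matrices act on column vectors of length \<open>N\<close>, modelled as functions
  vanishing from \<open>N\<close> on; this space \<open>U\<close> has dimension
  \<open>N\<close>.\<close>

lemma matrix_units_dvd:
  fixes X :: "nat \<Rightarrow> nat \<Rightarrow> nat \<Rightarrow> nat \<Rightarrow> 'k::field"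
  assumes n: "0 < n"
    and mult: "\<And>i j k l p q. i < n \<Longrightarrow> j < n \<Longrightarrow> k < n \<Longrightarrow> l < n \<Longrightarrow> p < N \<Longrightarrow> q < N \<Longrightarrow>
        mat_mult N (X i j) (X k l) p q = (if j = k then X i l p q else 0)"
    and one: "\<And>p q. p < N \<Longrightarrow> q < N \<Longrightarrow> (\<Sum>i<n. X i i p q) = (if p = q then 1 else 0)"
  shows "n dvd N"
proof -
  interpret V: vector_space "\<lambda>(c::'k) (v::nat \<Rightarrow> 'k) p. c * v p"
    by unfold_locales (simp_all add: fun_eq_iff plus_fun_def algebra_simps)
  define U where "U = {v :: nat \<Rightarrow> 'k. \<forall>p\<ge>N. v p = 0}"
  define d where "d = (\<lambda>(i::nat) p. if p = i then 1 else 0 :: 'k)"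
  \<comment> \<open>Setting entries from \<open>N\<close> on to 0 keeps the operators inside
    \<open>U\<close>.\<close>
  define e where "e = (\<lambda>i j (v :: nat \<Rightarrow> 'k) p. if p < N then \<Sum>q<N. X i j p q * v q else 0)"
  have sum_fun: "(\<Sum>i\<in>A. g i) p = (\<Sum>i\<in>A. g i p)" for g :: "nat \<Rightarrow> nat \<Rightarrow> 'k" and A p
    by (induction A rule: infinite_finite_induct) (simp_all add: zero_fun_def plus_fun_def)
  have U: "V.subspace U"
    by (rule V.subspaceI) (auto simp: U_def zero_fun_def plus_fun_def)
  have expand: "v = (\<Sum>i<N. (\<lambda>p. v i * d i p))" if "v \<in> U" for v
  proof
    fix p
    have "(\<Sum>i<N. v i * d i p) = (\<Sum>i<N. if p = i then v i else 0)"
      by (intro sum.cong refl) (simp add: d_def)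
    also have "\<dots> = v p" using that by (auto simp: U_def)
    finally show "v p = (\<Sum>i<N. (\<lambda>p. v i * d i p)) p" by (simp add: sum_fun)
  qed
  have span: "U \<subseteq> V.span (d ` {..<N})"
  proof
    fix v assume "v \<in> U"
    have "(\<Sum>i<N. (\<lambda>p. v i * d i p)) \<in> V.span (d ` {..<N})"
      by (intro V.span_sum V.span_scale V.span_base) auto
    then show "v \<in> V.span (d ` {..<N})" using expand[OF \<open>v \<in> U\<close>] by simp
  qed
  have inj: "inj_on d {..<N}"
    by (rule inj_onI) (metis d_def zero_neq_one)
  have "V.independent (d ` {..<N})"
  proof
    assume "V.dependent (d ` {..<N})"
    then obtain u where u: "\<exists>v\<in>d ` {..<N}. u v \<noteq> 0" "(\<Sum>v\<in>d ` {..<N}. (\<lambda>p. u v * v p)) = 0"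
      using V.dependent_finite[of "d ` {..<N}"] by auto
    then obtain k where k: "k < N" "u (d k) \<noteq> 0" by auto
    have "(\<Sum>i<N. (\<lambda>p. u (d i) * d i p)) = 0" using u(2) by (simp add: sum.reindex[OF inj])
    then have "(\<Sum>i<N. u (d i) * d i k) = 0" using sum_fun[of "\<lambda>i p. u (d i) * d i p" "{..<N}" k] by (simp add: zero_fun_def)
    moreover have "(\<Sum>i<N. u (d i) * d i k) = (\<Sum>i<N. if k = i then u (d i) else 0)"
      by (intro sum.cong refl) (simp add: d_def)
    ultimately show False using k by simp
  qed
  moreover have "d ` {..<N} \<subseteq> U" by (auto simp: U_def d_def)
  ultimately have "card (d ` {..<N}) = V.dim U" using span by (intro V.basis_card_eq_dim)
  then have "V.dim U = N" by (simp add: card_image[OF inj])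
  moreover have "n dvd V.dim U"
  proof (rule V.matrix_units_dvd_dim[OF n U _ span])
    show "finite (d ` {..<N})" by simp
    show "e i j (x + y) = e i j x + e i j y" for i j x y
      by (simp add: e_def fun_eq_iff plus_fun_def sum.distrib algebra_simps)
    show "e i j (\<lambda>p. c * x p) = (\<lambda>p. c * e i j x p)" for i j c x
      by (simp add: e_def fun_eq_iff sum_distrib_left algebra_simps)
    show "e i j x \<in> U" for i j x by (simp add: e_def U_def)
    show "e i j (e k l x) = (if j = k then e i l x else 0)"
      if "i < n" "j < n" "k < n" "l < n" for i j k l x
    proof
      fix p
      show "e i j (e k l x) p = (if j = k then e i l x else 0) p"
      proof (cases "p < N")
        case True
        have "e i j (e k l x) p = (\<Sum>q<N. X i j p q * (\<Sum>r<N. X k l q r * x r))"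
          using True by (simp add: e_def)
        also have "\<dots> = (\<Sum>q<N. \<Sum>r<N. X i j p q * X k l q r * x r)"
          by (simp add: sum_distrib_left mult.assoc)
        also have "\<dots> = (\<Sum>r<N. mat_mult N (X i j) (X k l) p r * x r)"
          by (subst sum.swap) (simp add: mat_mult_def sum_distrib_right)
        also have "\<dots> = (\<Sum>r<N. (if j = k then X i l p r else 0) * x r)"
          using True that by (intro sum.cong refl) (simp add: mult)
        finally show ?thesis using True by (simp add: e_def zero_fun_def)
      qed (simp add: e_def zero_fun_def)
    qed
    show "(\<Sum>i<n. e i i x) = x" if "x \<in> U" for x
    proof
      fix p
      show "(\<Sum>i<n. e i i x) p = x p"
      proof (cases "p < N")
        case True
        have "(\<Sum>i<n. e i i x) p = (\<Sum>i<n. \<Sum>q<N. X i i p q * x q)"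
          using True by (simp add: sum_fun e_def)
        also have "\<dots> = (\<Sum>q<N. (\<Sum>i<n. X i i p q) * x q)"
          by (subst sum.swap) (simp add: sum_distrib_right)
        also have "\<dots> = (\<Sum>q<N. if p = q then x q else 0)"
          using True by (intro sum.cong refl) (simp add: one)
        also have "\<dots> = x p" using True by simp
        finally show ?thesis .
      next
        case False
        then show ?thesis using that by (simp add: sum_fun e_def U_def)
      qed
    qed
  qed
  ultimately show ?thesis by simp
qed

section \<open>Matrix subalgebras of the Clifford algebra\<close>

context clifford
begin

lemma cl_matrix_embedding_mat_units:
  assumes "cl_matrix_embedding s f n \<phi>"
  shows "\<exists>e. mat_units n e"
proof -
  define \<psi> where "\<psi> = (\<lambda>X. Falg (\<phi> X))"
  have coef_\<psi>: "coef (\<psi> X) = \<phi> X" if "X \<in> mat_carrier n" for X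
    using assms that unfolding cl_matrix_embedding_def \<psi>_def by (intro Falg_inverse) blast
  have add_carrier: "mat_add X Y \<in> mat_carrier n" if "X \<in> mat_carrier n" "Y \<in> mat_carrier n" for X Y :: "nat \<Rightarrow> nat \<Rightarrow> 'k"
    using that by (auto simp: mat_add_def mat_carrier_def)
  have scale_carrier: "mat_scale c X \<in> mat_carrier n" if "X \<in> mat_carrier n" for c and X :: "nat \<Rightarrow> nat \<Rightarrow> 'k"
    using that by (auto simp: mat_scale_def mat_carrier_def)
  have mult_carrier: "mat_mult n X Y \<in> mat_carrier n" if "X \<in> mat_carrier n" "Y \<in> mat_carrier n" for X Y :: "nat \<Rightarrow> nat \<Rightarrow> 'k"
    using that by (auto simp: mat_mult_def mat_carrier_def intro!: sum.neutral)
  have one_carrier: "(mat_one n :: nat \<Rightarrow> nat \<Rightarrow> 'k) \<in> mat_carrier n"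
    by (auto simp: mat_one_def mat_carrier_def)
  have \<psi>_add: "\<psi> (mat_add X Y) \<simeq> \<psi> X + \<psi> Y" if "X \<in> mat_carrier n" "Y \<in> mat_carrier n" for X Y
    using assms that unfolding cl_matrix_embedding_def cl_eq_coef[symmetric]
    by (simp add: coef_\<psi> add_carrier plus_falg.rep_eq)
  have \<psi>_scale: "\<psi> (mat_scale c X) \<simeq> fsc c (\<psi> X)" if "X \<in> mat_carrier n" for c X
    using assms that unfolding cl_matrix_embedding_def cl_eq_coef[symmetric]
    by (simp add: coef_\<psi> scale_carrier fsc.rep_eq)
  have \<psi>_mult: "\<psi> (mat_mult n X Y) \<simeq> \<psi> X * \<psi> Y" if "X \<in> mat_carrier n" "Y \<in> mat_carrier n" for X Y
    using assms that unfolding cl_matrix_embedding_def cl_eq_coef[symmetric]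
    by (simp add: coef_\<psi> mult_carrier times_falg.rep_eq)
  have \<psi>_one: "\<psi> (mat_one n) \<simeq> 1"
    using assms unfolding cl_matrix_embedding_def cl_eq_coef[symmetric]
    by (simp add: coef_\<psi> one_carrier one_falg.rep_eq)
  have \<psi>_zero: "\<psi> (\<lambda>p q. 0) \<simeq> 0"
    using \<psi>_scale[OF one_carrier, of 0] by (simp add: mat_scale_def)
  define u where "u = (\<lambda>(i::nat) (j::nat) p q. if p = i \<and> q = j then 1 else 0 :: 'k)"
  have u: "u i j \<in> mat_carrier n" if "i < n" "j < n" for i j
    using that by (auto simp: u_def mat_carrier_def)
  have uu: "mat_mult n (u i j) (u k l) = (if j = k then u i l else (\<lambda>p q. 0))" if "j < n" for i j k l
  proof (intro ext)
    fix p q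
    have "mat_mult n (u i j) (u k l) p q = (\<Sum>r<n. if r = j then if p = i \<and> j = k \<and> q = l then 1 else 0 else 0)"
      unfolding mat_mult_def by (intro sum.cong refl) (auto simp: u_def)
    also have "\<dots> = (if p = i \<and> j = k \<and> q = l then 1 else 0)" using that by simp
    finally show "mat_mult n (u i j) (u k l) p q = (if j = k then u i l else (\<lambda>p q. 0)) p q"
      by (simp add: u_def)
  qed
  have "\<psi> (u i j) * \<psi> (u k l) \<simeq> (if j = k then \<psi> (u i l) else 0)"
    if "i < n" "j < n" "k < n" "l < n" for i j k l
  proof -
    have "\<psi> (u i j) * \<psi> (u k l) \<simeq> \<psi> (mat_mult n (u i j) (u k l))"
      by (intro ceq_sym[OF \<psi>_mult] u that)
    also have "\<dots> \<simeq> (if j = k then \<psi> (u i l) else 0)"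
      using \<psi>_zero by (simp add: uu[OF that(2)])
    finally show ?thesis .
  qed
  moreover have "(\<Sum>i<n. \<psi> (u i i)) \<simeq> 1"
  proof -
    \<comment> \<open>Partial identity matrices: additivity of the embedding is available for two
      summands, so the diagonal units are added one by one.\<close>
    let ?d = "\<lambda>m p q. if p = q \<and> p < m then 1 else 0 :: 'k"
    have "(\<Sum>i<m. \<psi> (u i i)) \<simeq> \<psi> (?d m)" if "m \<le> n" for m
      using that
    proof (induction m)
      case 0
      then show ?case using ceq_sym[OF \<psi>_zero] by simp
    next
      case (Suc m)
      have dm: "?d m \<in> mat_carrier n" using Suc.prems by (auto simp: mat_carrier_def)
      have "(\<Sum>i<Suc m. \<psi> (u i i)) \<simeq> \<psi> (?d m) + \<psi> (u m m)"
        using ceq_add[OF Suc.IH ceq_refl] Suc.prems by simp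
      also have "\<dots> \<simeq> \<psi> (mat_add (?d m) (u m m))"
        using Suc.prems by (intro ceq_sym[OF \<psi>_add] dm u) auto
      also have "mat_add (?d m) (u m m) = ?d (Suc m)"
        by (auto simp: mat_add_def u_def fun_eq_iff)
      finally show ?case .
    qed
    from this[of n] have "(\<Sum>i<n. \<psi> (u i i)) \<simeq> \<psi> (mat_one n)" by (simp add: mat_one_def)
    then show ?thesis using \<psi>_one by (rule ceq_trans)
  qed
  ultimately have "mat_units n (\<lambda>i j. \<psi> (u i j))" unfolding mat_units_def by blast
  then show ?thesis by blast
qed

text \<open>By \<open>mat_map_inj\<close>, relations modulo \<open>I\<close> become exact equations
  between coordinate matrices, so the \<open>X i j\<close> are genuine matrix units of size
  \<open>n\<close> among the \<open>N\<close> by \<open>N\<close> matrices.\<close>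

lemma mat_units_dvd:
  assumes E: "mat_units N E" and e: "mat_units n e" "0 < n"
    and sub: "\<And>i j. i < n \<Longrightarrow> j < n \<Longrightarrow> e i j \<in> mat_span N E"
  shows "n dvd N"
proof -
  have "\<forall>i j. \<exists>X. i < n \<longrightarrow> j < n \<longrightarrow> e i j \<simeq> mat_map N E X"
    using sub unfolding mat_span_def by blast
  then obtain X where X: "\<And>i j. i < n \<Longrightarrow> j < n \<Longrightarrow> e i j \<simeq> mat_map N E (X i j)"
    by metis
  show ?thesis
  proof (rule matrix_units_dvd[OF e(2)])
    show "mat_mult N (X i j) (X k l) p q = (if j = k then X i l p q else 0)"
      if ijkl: "i < n" "j < n" "k < n" "l < n" and pq: "p < N" "q < N" for i j k l p q
    proof -
      have "mat_map N E (mat_mult N (X i j) (X k l)) \<simeq> mat_map N E (X i j) * mat_map N E (X k l)"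
        by (rule ceq_sym[OF mat_map_mult[OF E]])
      also have "\<dots> \<simeq> e i j * e k l" by (intro ceq_mult ceq_sym[OF X] ijkl)
      also have "\<dots> \<simeq> (if j = k then e i l else 0)" by (rule mat_units_mult[OF e(1) ijkl])
      also have "\<dots> \<simeq> mat_map N E (\<lambda>p q. if j = k then X i l p q else 0)"
        using X[OF ijkl(1,4)] by (simp add: mat_map_def)
      finally show ?thesis by (rule mat_map_inj[OF E _ pq])
    qed
    show "(\<Sum>i<n. X i i p q) = (if p = q then 1 else 0)" if pq: "p < N" "q < N" for p q
    proof -
      have "mat_map N E (\<lambda>p q. \<Sum>i<m. X i i p q) = (\<Sum>i<m. mat_map N E (X i i))" for m
        by (induction m) (simp_all add: mat_map_def falg.scale_left_distrib sum.distrib)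
      then have "mat_map N E (\<lambda>p q. \<Sum>i<n. X i i p q) = (\<Sum>i<n. mat_map N E (X i i))" .
      also have "\<dots> \<simeq> (\<Sum>i<n. e i i)" by (intro ceq_sum ceq_sym[OF X]) auto
      also have "\<dots> \<simeq> 1" by (rule mat_units_sum[OF e(1)])
      also have "\<dots> \<simeq> mat_map N E (mat_one N)"
        using ceq_sym[OF mat_units_sum[OF E]] by (simp add: mat_map_one)
      finally have "(\<Sum>i<n. X i i p q) = mat_one N p q" by (rule mat_map_inj[OF E _ pq])
      then show ?thesis using pq by (simp add: mat_one_def)
    qed
  qed
qed

end

section \<open>The Steinitz number\<close>

context nondegenerate_clifford
begin

text \<open>The \<open>n * n\<close> matrix units of a subalgebra form a finite set, so a matrix
  algebra of size \<open>2 ^ m\<close> contains them all.\<close>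

lemma D_dvd_two_power:
  assumes "n \<in> clifford_D s f"
  obtains m where "n dvd 2 ^ m"
proof -
  from assms obtain \<phi> where \<phi>: "cl_matrix_embedding s f n \<phi>" by (auto simp: clifford_D_def)
  then have n: "0 < n" by (simp add: cl_matrix_embedding_def)
  obtain e where e: "mat_units n e" using cl_matrix_embedding_mat_units[OF \<phi>] by blast
  obtain m E where E: "mat_units (2 ^ m) E" "(\<lambda>(i, j). e i j) ` ({..<n} \<times> {..<n}) \<subseteq> mat_span (2 ^ m) E"
    using finite_subset_mat_span[of "(\<lambda>(i, j). e i j) ` ({..<n} \<times> {..<n})"] by blast
  have "n dvd 2 ^ m" using E(2) by (intro mat_units_dvd[OF E(1) e n]) auto
  then show ?thesis by (rule that)
qed

lemma steinitz_D: "steinitz_lcm (clifford_D s f) = steinitz_two_inf"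
proof
  fix p :: nat
  show "steinitz_lcm (clifford_D s f) p = steinitz_two_inf p"
  proof (cases "p = 2")
    case True
    \<comment> \<open>The exponent \<open>m\<close> is attained by the subalgebra of size
      \<open>2 ^ m\<close>, so the supremum exceeds every finite bound.\<close>
    have "enat m \<le> (SUP n\<in>clifford_D s f. enat (multiplicity 2 n))" for m
      using SUP_upper[OF two_power_in_D[of m], of "\<lambda>n. enat (multiplicity 2 n)"] by simp
    then have "(SUP n\<in>clifford_D s f. enat (multiplicity 2 n)) = \<infinity>"
      by (metis enat_ord_simps(1) not_infinity_eq Suc_n_not_le_n)
    then show ?thesis using True by (simp add: steinitz_lcm_def steinitz_two_inf_def)
  next
    case False
    have "multiplicity p n = 0" if "prime p" "n \<in> clifford_D s f" for n
    proof -
      obtain m where m: "n dvd 2 ^ m" using \<open>n \<in> clifford_D s f\<close> by (rule D_dvd_two_power)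
      have "\<not> p dvd n"
      proof
        assume "p dvd n"
        then have "p dvd 2 ^ m" using m dvd_trans by blast
        then show False using that(1) False prime_dvd_power primes_dvd_imp_eq two_is_prime_nat by blast
      qed
      then show ?thesis by (rule not_dvd_imp_multiplicity_0)
    qed
    then have "(SUP n\<in>clifford_D s f. enat (multiplicity p n)) \<le> 0" if "prime p"
      using that by (intro SUP_least) (simp add: zero_enat_def)
    then show ?thesis using False by (simp add: steinitz_lcm_def steinitz_two_inf_def)
  qed
qed

end

theorem theorem5:
  fixes s :: "'k::field \<Rightarrow> 'v::ab_group_add \<Rightarrow> 'v"
    and f :: "'v \<Rightarrow> 'k"
  assumes "alg_closed TYPE('k)"
    and "(2::'k) \<noteq> 0"
    and "vector_space s"
    and "infinite_dimensional s"
    and "quadratic_form s f"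
    and "nondegenerate_qf f"
  shows "clifford_locally_matrix s f \<and> steinitz_lcm (clifford_D s f) = steinitz_two_inf"
proof -
  interpret nondegenerate_clifford s f
    using assms
    by (simp add: nondegenerate_clifford_def clifford_def clifford_axioms_def
        nondegenerate_clifford_axioms_def)
  show ?thesis using locally_matrix steinitz_D by blast
qed

end
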